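(* Let $d\ge1$ and $\boldsymbol\mu=(\mu_1,\dots,\mu_d)$ with $\mu_i>0$. Let $Q^P_n(\boldsymbol x,\boldsymbol y;\boldsymbol\mu)$, $n\ge0$, $\boldsymbol x,\boldsymbol y\in\mathbb Z_+^d$, be the reproducing kernel polynomials on the product Poisson distribution $P(\boldsymbol x;\boldsymbol\mu)=\prod_{i=1}^de^{-\mu_i}\mu_i^{x_i}/x_i!$. (a) Let $\boldsymbol X^{(N)}$ be a $(d+1)$-dimensional multinomial $(N,(\boldsymbol p,p_{d+1}))$ random vector with $\boldsymbol p=(p_1,\dots,p_d)$ (depending on $N$) and $p_{d+1}=1-|\boldsymbol p|$. Then as $N\to\infty$, $\boldsymbol p\to0$ with $N\boldsymbol p\to\boldsymbol\mu$, the first $d$ elements of $\boldsymbol X^{(N)}$ converge in distribution to the product Poisson distribution $P(\cdot;\boldsymbol\mu)$, and for fixed $\boldsymbol x,\boldsymbol y\in\mathbb Z_+^d$ and $n\ge0$, $$Q_n\big(\boldsymbol x^{(N)},\boldsymbol y^{(N)};N,(\boldsymbol p,p_{d+1})\big)\to Q_n^P(\boldsymbol x,\boldsymbol y;\boldsymbol\mu),$$ where $\boldsymbol x^{(N)}=(\boldsymbol x,N-|\boldsymbol x|)$, $\boldsymbol y^{(N)}=(\boldsymbol y,N-|\boldsymbol y|)$. (b) The Poisson kernel, non-negative for $0\le\rho\le1$, is $$1+\sum_{n=1}^\infty\rho^nQ_n^P(\boldsymbol x,\boldsymbol y;\boldsymbol\mu)=e^{|\boldsymbol\mu|\rho}\sum_{\boldsymbol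 z\le\boldsymbol x,\boldsymbol y}\rho^{|\boldsymbol z|}(1-\rho)^{|\boldsymbol x|+|\boldsymbol y|-2|\boldsymbol z|}\prod_{i=1}^d\frac{(x_i)_{[z_i]}(y_i)_{[z_i]}}{\mu_i^{z_i}z_i!}.$$ (c) For $n\ge0$, $$Q_n^P(\boldsymbol x,\boldsymbol y;\boldsymbol\mu)=\sum_{\boldsymbol z\le\boldsymbol x,\boldsymbol y:\ |\boldsymbol z|\le n}\frac{|\boldsymbol\mu|^{n-|\boldsymbol z|}}{(n-|\boldsymbol z|)!}\,C_{n-|\boldsymbol z|}\big(|\boldsymbol x|+|\boldsymbol y|-2|\boldsymbol z|;|\boldsymbol\mu|\big)\prod_{i=1}^d\frac{(x_i)_{[z_i]}(y_i)_{[z_i]}}{\mu_i^{z_i}z_i!},$$ where $\{C_n(x;\lambda)\}_{n\ge0}$ are the Poisson–Charlier polynomials, with generating function $\sum_{n=0}^\infty C_n(x;\lambda)\frac{z^n}{n!}=e^z\big(1-\frac z\lambda\big)^x$.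
   Context: Notation: $|\boldsymbol x|=\sum_ix_i$; $\boldsymbol z\le\boldsymbol x,\boldsymbol y$ means $\boldsymbol z\in\mathbb Z_+^d$ with $z_i\le x_i,y_i$ for all $i$; $x_{[k]}=x(x-1)\cdots(x-k+1)$, $x_{[0]}=1$; $0^0=1$. Reproducing kernel polynomials of a distribution: if $\{Q^\circ_{\boldsymbol n}\}$ is a complete set of orthonormal polynomials on the distribution, with $Q^\circ_{\boldsymbol n}$ of total degree $|\boldsymbol n|$, the $n$th reproducing kernel polynomial is $\sum_{|\boldsymbol n|=n}Q^\circ_{\boldsymbol n}(\boldsymbol x)Q^\circ_{\boldsymbol n}(\boldsymbol y)$; it does not depend on the choice of the orthonormal set. $Q^P_n(\boldsymbol x,\boldsymbol y;\boldsymbol\mu)$ is this object for the product Poisson distribution. $Q_n(\cdot,\cdot;N,(\boldsymbol p,p_{d+1}))$ is this object for the $(d+1)$-dimensional multinomial distribution with probabilities $N!\prod_{j=1}^{d+1}p_j^{x_j}/x_j!$ on $\{\boldsymbol x\in\mathbb Z_+^{d+1}:|\boldsymbol x|=N\}$, where the index $\boldsymbol n$ runs over $\mathbb Z_+^d$ with $|\boldsymbol n|\le N$ (the space of polynomial functions of total degree at most $n$ restricted to this set, for $n\le N$). *)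

theory Defs
  imports "HOL-Probability.Probability" "HOL-Computational_Algebra.Formal_Power_Series"
begin

text \<open>
  Vectors in \<open>\<int>\<^sub>+\<^sup>d\<close> are functions \<open>'d \<Rightarrow> nat\<close> on a finite index type with \<open>d = CARD('d) \<ge> 1\<close>;
  vectors with \<open>d + 1\<close> entries are indexed by \<open>'d option\<close>, where \<open>None\<close> is the last index.
  The order on vectors is the pointwise order of the function space.
\<close>

abbreviation total :: "('a::finite \<Rightarrow> 'b::comm_monoid_add) \<Rightarrow> 'b" where
  "total x \<equiv> sum x UNIV"

definition append_last :: "('d \<Rightarrow> 'b) \<Rightarrow> 'b \<Rightarrow> 'd option \<Rightarrow> 'b" where
  "append_last x a j = (case j of Some i \<Rightarrow> x i | None \<Rightarrow> a)"

definition falling :: "nat \<Rightarrow> nat \<Rightarrow> real" where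
  "falling x k = (\<Prod>j<k. real x - real j)"


subsection \<open>Distributions\<close>

definition product_poisson :: "('d::finite \<Rightarrow> real) \<Rightarrow> ('d \<Rightarrow> nat) pmf" where
  "product_poisson \<mu> = Pi_pmf UNIV 0 (\<lambda>i. poisson_pmf (\<mu> i))"

lemma pmf_product_poisson:
  assumes "\<And>i. 0 < \<mu> i"
  shows "pmf (product_poisson \<mu>) x = (\<Prod>i\<in>UNIV. exp (- \<mu> i) * \<mu> i ^ x i / fact (x i))"
  unfolding product_poisson_def
  by (subst pmf_Pi) (auto intro!: prod.cong simp: assms)

definition multinomial_mass :: "nat \<Rightarrow> ('a::finite \<Rightarrow> real) \<Rightarrow> ('a \<Rightarrow> nat) \<Rightarrow> real" where
  "multinomial_mass N p x =
     (if total x = N then fact N * (\<Prod>j\<in>UNIV. p j ^ x j / fact (x j)) else 0)"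

definition multinomial_pmf :: "nat \<Rightarrow> ('a::finite \<Rightarrow> real) \<Rightarrow> ('a \<Rightarrow> nat) pmf" where
  "multinomial_pmf N p = embed_pmf (multinomial_mass N p)"

lemma finite_compositions:
  assumes "finite S"
  shows "finite {x :: 'a \<Rightarrow> nat. (\<forall>i. i \<notin> S \<longrightarrow> x i = 0) \<and> sum x S = N}"
proof (rule finite_subset)
  show "{x :: 'a \<Rightarrow> nat. (\<forall>i. i \<notin> S \<longrightarrow> x i = 0) \<and> sum x S = N} \<subseteq> PiE_dflt S 0 (\<lambda>_. {..N})"
    using assms by (auto simp: PiE_dflt_def intro: member_le_sum)
  show "finite (PiE_dflt S (0::nat) (\<lambda>_. {..N}))"
    using assms by (intro finite_PiE_dflt) auto
qed

lemma multinomial_theorem: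
  fixes p :: "'a \<Rightarrow> real"
  assumes "finite S"
  shows "(\<Sum>x | (\<forall>i. i \<notin> S \<longrightarrow> x i = 0) \<and> sum x S = N. \<Prod>i\<in>S. p i ^ x i / fact (x i))
           = sum p S ^ N / fact N"
  using assms
proof (induction S arbitrary: N rule: finite_induct)
  case empty
  have "{x :: 'a \<Rightarrow> nat. (\<forall>i. x i = 0) \<and> 0 = N} = (if N = 0 then {\<lambda>_. 0} else {})"
    by auto
  then show ?case by simp
next
  case (insert a S)
  let ?X = "\<lambda>S N. {x :: 'a \<Rightarrow> nat. (\<forall>i. i \<notin> S \<longrightarrow> x i = 0) \<and> sum x S = N}"
  let ?g = "\<lambda>x. \<Prod>i\<in>S. p i ^ x i / fact (x i)"
  have upd_sum: "(\<Sum>i\<in>S. if i = a then k else x i) = sum x S" for x :: "'a \<Rightarrow> nat" and k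
    by (rule sum.cong) (use insert.hyps in auto)
  have upd_prod: "(\<Prod>i\<in>S. p i ^ (if i = a then k else x i) / fact (if i = a then k else x i)) = ?g x"
    for x :: "'a \<Rightarrow> nat" and k
    by (rule prod.cong) (use insert.hyps in auto)
  have "(\<Sum>x\<in>?X (insert a S) N. \<Prod>i\<in>insert a S. p i ^ x i / fact (x i))
      = (\<Sum>(k, x)\<in>Sigma {..N} (\<lambda>k. ?X S (N - k)). p a ^ k / fact k * ?g x)"
  proof (rule sum.reindex_bij_witness
      [where i = "\<lambda>(k, x). x(a := k)" and j = "\<lambda>x. (x a, x(a := 0))"], goal_cases)
    case (1 x) then show ?case by auto
  next
    case (2 x) then show ?case using insert.hyps by (auto simp: fun_upd_def upd_sum)
  next
    case (3 y) then show ?case using insert.hyps by (auto simp: fun_eq_iff)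
  next
    case (4 y) then show ?case using insert.hyps by (auto simp: fun_upd_def upd_sum)
  next
    case (5 x) then show ?case using insert.hyps by (auto simp: fun_upd_def upd_prod)
  qed
  also have "\<dots> = (\<Sum>k\<le>N. \<Sum>x\<in>?X S (N - k). p a ^ k / fact k * ?g x)"
    by (rule sum.Sigma[symmetric]) (use insert.hyps in \<open>auto intro: finite_compositions\<close>)
  also have "\<dots> = (\<Sum>k\<le>N. p a ^ k / fact k * (sum p S ^ (N - k) / fact (N - k)))"
    by (simp only: sum_distrib_left[symmetric] insert.IH)
  also have "\<dots> = (\<Sum>k\<le>N. real (N choose k) * p a ^ k * sum p S ^ (N - k)) / fact N"
    unfolding sum_divide_distrib
    by (rule sum.cong) (auto simp: binomial_fact field_simps)
  also have "\<dots> = (p a + sum p S) ^ N / fact N"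
    by (simp add: binomial_ring)
  finally show ?case using insert.hyps by simp
qed

lemma pmf_multinomial:
  assumes "\<And>j. 0 \<le> p j" "total p = 1"
  shows "pmf (multinomial_pmf N p) x = multinomial_mass N p x"
  unfolding multinomial_pmf_def
proof (rule pmf_embed_pmf)
  show nonneg: "0 \<le> multinomial_mass N p x" for x
    using assms by (auto simp: multinomial_mass_def intro!: mult_nonneg_nonneg prod_nonneg)
  have fin: "finite {x :: 'a \<Rightarrow> nat. total x = N}"
    using finite_compositions[of "UNIV :: 'a set" N] by simp
  have "(\<integral>\<^sup>+x. ennreal (multinomial_mass N p x) \<partial>count_space UNIV)
      = (\<Sum>x | total x = N. ennreal (multinomial_mass N p x))"
    by (rule nn_integral_count_space'[OF fin]) (auto simp: multinomial_mass_def)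
  also have "\<dots> = ennreal (\<Sum>x | total x = N. multinomial_mass N p x)"
    using nonneg by (simp add: sum_ennreal)
  also have "(\<Sum>x | total x = N. multinomial_mass N p x)
      = fact N * (\<Sum>x | total x = N. \<Prod>j\<in>UNIV. p j ^ x j / fact (x j))"
    by (simp add: multinomial_mass_def sum_distrib_left)
  also have "\<dots> = 1"
    using multinomial_theorem[of "UNIV :: 'a set" p N] assms by simp
  finally show "(\<integral>\<^sup>+x. ennreal (multinomial_mass N p x) \<partial>count_space UNIV) = 1"
    by simp
qed

text \<open>
  Weak convergence on an arbitrary topological space; the library's \<open>weak_conv_m\<close> covers only
  measures on the real line.
\<close>

definition weakly_converges ::
  "(nat \<Rightarrow> 'a::topological_space measure) \<Rightarrow> 'a measure \<Rightarrow> bool" where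
  "weakly_converges Ms M \<longleftrightarrow>
     (\<forall>f :: 'a \<Rightarrow> real. continuous_on UNIV f \<longrightarrow> bounded (range f) \<longrightarrow>
        (\<lambda>N. \<integral>x. f x \<partial>Ms N) \<longlonglongrightarrow> (\<integral>x. f x \<partial>M))"

definition real_vec :: "('d::finite \<Rightarrow> nat) \<Rightarrow> real ^ 'd" where
  "real_vec x = (\<chi> i. real (x i))"


subsection \<open>Reproducing kernel polynomials\<close>

definition poly_le_on :: "('a::finite \<Rightarrow> nat) set \<Rightarrow> nat \<Rightarrow> (('a \<Rightarrow> nat) \<Rightarrow> real) \<Rightarrow> bool" where
  "poly_le_on S k f \<longleftrightarrow>
     (\<exists>c :: ('a \<Rightarrow> nat) \<Rightarrow> real. \<forall>x\<in>S. f x = (\<Sum>m | total m \<le> k. c m * (\<Prod>i\<in>UNIV. real (x i) ^ m i)))"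

definition poly_degree_on :: "('a::finite \<Rightarrow> nat) set \<Rightarrow> nat \<Rightarrow> (('a \<Rightarrow> nat) \<Rightarrow> real) \<Rightarrow> bool" where
  "poly_degree_on S k f \<longleftrightarrow> poly_le_on S k f \<and> (\<forall>j<k. \<not> poly_le_on S j f)"

text \<open>
  Polynomials matter only through their values on the support of the distribution, so total degree
  and completeness refer to the restrictions to the support.  The multi-indices of the orthonormal
  polynomials may have fewer entries than the arguments: for a \<open>(d + 1)\<close>-dimensional multinomial
  distribution they lie in \<open>\<int>\<^sub>+\<^sup>d\<close>.  No integrability condition is needed: \<open>E[Q\<^sub>n\<^sup>2] = 1\<close> already
  makes each \<open>Q\<^sub>n\<close> square integrable, because the expectation of a non-integrable function is 0.
\<close>

definition complete_orthonormal ::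
  "('a::finite \<Rightarrow> nat) pmf \<Rightarrow> ('b::finite \<Rightarrow> nat) set \<Rightarrow> (('b \<Rightarrow> nat) \<Rightarrow> ('a \<Rightarrow> nat) \<Rightarrow> real) \<Rightarrow> bool" where
  "complete_orthonormal P I Q \<longleftrightarrow>
     (\<forall>n\<in>I. poly_degree_on (set_pmf P) (total n) (Q n)) \<and>
     (\<forall>m\<in>I. \<forall>n\<in>I. measure_pmf.expectation P (\<lambda>x. Q m x * Q n x) = (if m = n then 1 else 0)) \<and>
     (\<forall>k f. poly_le_on (set_pmf P) k f \<longrightarrow>
        (\<exists>c. \<forall>x\<in>set_pmf P. f x = (\<Sum>n | n \<in> I \<and> total n \<le> k. c n * Q n x)))"

text \<open>
  The description is proper, for points \<open>x\<close>, \<open>y\<close> in the support of \<open>P\<close>, exactly when a complete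
  orthonormal set exists and the sum does not depend on its choice.
\<close>

definition reproducing_kernel ::
  "('a::finite \<Rightarrow> nat) pmf \<Rightarrow> ('b::finite \<Rightarrow> nat) set \<Rightarrow> nat \<Rightarrow> ('a \<Rightarrow> nat) \<Rightarrow> ('a \<Rightarrow> nat) \<Rightarrow> real" where
  "reproducing_kernel P I n x y =
     (THE v. \<exists>Q. complete_orthonormal P I Q \<and> v = (\<Sum>m | m \<in> I \<and> total m = n. Q m x * Q m y))"

definition poisson_kernel_poly ::
  "nat \<Rightarrow> ('d::finite \<Rightarrow> nat) \<Rightarrow> ('d \<Rightarrow> nat) \<Rightarrow> ('d \<Rightarrow> real) \<Rightarrow> real" where
  "poisson_kernel_poly n x y \<mu> =
     reproducing_kernel (product_poisson \<mu>) (UNIV :: ('d \<Rightarrow> nat) set) n x y"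

definition multinomial_kernel_poly ::
  "nat \<Rightarrow> ('d::finite option \<Rightarrow> nat) \<Rightarrow> ('d option \<Rightarrow> nat) \<Rightarrow> nat \<Rightarrow> ('d option \<Rightarrow> real) \<Rightarrow> real" where
  "multinomial_kernel_poly n x y N p =
     reproducing_kernel (multinomial_pmf N p) {m :: 'd \<Rightarrow> nat. total m \<le> N} n x y"


subsection \<open>Poisson-Charlier polynomials\<close>

text \<open>
  \<open>C\<^sub>n(x; a)\<close> at \<open>x \<in> \<int>\<^sub>+\<close> is \<open>n!\<close> times the coefficient of \<open>z\<^sup>n\<close> in \<open>e\<^sup>z (1 - z / a)\<^sup>x\<close>.
\<close>

definition charlier :: "nat \<Rightarrow> nat \<Rightarrow> real \<Rightarrow> real" where
  "charlier n x a = fact n * fps_nth (fps_exp 1 * (1 - fps_const (1 / a) * fps_X) ^ x) n"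

end

theory Submission
  imports Defs
begin

text \<open>
  The kernel does not depend on the orthonormal set because two such sets of the polynomials of degree
  at most \<open>n\<close> differ by an orthogonal change of basis.  For the product Poisson distribution, products of
  normalised Charlier polynomials form a complete orthonormal set: Poisson summation by parts,
  \<open>E[x f(x)] = \<mu> E[f(x + 1)]\<close>, reduces the Gram matrix of Charlier polynomials to lower degrees.  A
  Mehler type formula in one variable, proved from the recurrence
  \<open>H(x + 1, y) = (1 - \<rho>) H(x, y) + (\<rho> y / \<mu>) H(x, y - 1)\<close>, multiplies over the coordinates to the
  generating function in (b), whose coefficients give (c).

  For (a), the mass function of the first \<open>d\<close> multinomial coordinates converges pointwise and is dominated
  by a multiple of a product Poisson mass function, so expectations converge for all functions
  of at most exponential growth.  This covers bounded functions, and it shows that the multinomial Gram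
  matrix of the Charlier basis tends to the identity.  The coefficients of the
  multinomial kernel in that basis solve a linear system with this matrix, hence converge.
\<close>

subsection \<open>Spans and polynomials\<close>

text \<open>The multinomial orthonormal polynomials are never written down: many of them share a
  degree, and an arbitrary choice for each N has no reason to converge. What survives the choice is
  the kernel, so limits are taken for its coefficients in one basis that does not depend on N. The
  Charlier products of the limit law serve as that basis. They involve only the first d coordinates,
  but on the simplex |x| = N these already generate all polynomial functions, because the last
  coordinate is N minus their sum.

  Uniqueness and limits concern the spaces of degree at most n; degree exactly n is recovered as a
  difference of two such kernels. Since the kernel is a definite description, an orthonormal set
  must also be shown to exist for the multinomial law, which Gram-Schmidt in order of degree
  provides.

  The growth rate 4^x in the estimates comes from Charlier polynomials, bounded by a multiple of 2^x
  and multiplied in pairs.\<close>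

text \<open>Functions are compared on \<open>S\<close> only, since on a finite support different
  polynomials can agree; the family \<phi> may be linearly dependent there.\<close>

definition span_on :: "'a set \<Rightarrow> ('b \<Rightarrow> 'a \<Rightarrow> real) \<Rightarrow> 'b set \<Rightarrow> ('a \<Rightarrow> real) \<Rightarrow> bool" where
  "span_on S \<phi> A f \<longleftrightarrow> (\<exists>c. \<forall>x\<in>S. f x = (\<Sum>m\<in>A. c m * \<phi> m x))"

lemma span_on_cong: "(\<And>x. x \<in> S \<Longrightarrow> f x = g x) \<Longrightarrow> span_on S \<phi> A f = span_on S \<phi> A g"
  unfolding span_on_def by simp

lemma span_on_cong_basis:
  "(\<And>m x. m \<in> A \<Longrightarrow> x \<in> S \<Longrightarrow> \<phi> m x = \<psi> m x) \<Longrightarrow> span_on S \<phi> A f = span_on S \<psi> A f"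
  unfolding span_on_def by (simp cong: sum.cong)

lemma span_on_zero: "span_on S \<phi> A (\<lambda>_. 0)"
  unfolding span_on_def by (rule exI[of _ "\<lambda>_. 0"]) simp

lemma span_on_add:
  assumes "span_on S \<phi> A f" "span_on S \<phi> A g"
  shows "span_on S \<phi> A (\<lambda>x. f x + g x)"
proof -
  obtain c d where "\<forall>x\<in>S. f x = (\<Sum>m\<in>A. c m * \<phi> m x)" "\<forall>x\<in>S. g x = (\<Sum>m\<in>A. d m * \<phi> m x)"
    using assms unfolding span_on_def by blast
  then show ?thesis unfolding span_on_def
    by (intro exI[of _ "\<lambda>m. c m + d m"]) (simp add: sum.distrib distrib_right)
qed

lemma span_on_scale:
  assumes "span_on S \<phi> A f"
  shows "span_on S \<phi> A (\<lambda>x. a * f x)"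
proof -
  obtain c where "\<forall>x\<in>S. f x = (\<Sum>m\<in>A. c m * \<phi> m x)"
    using assms unfolding span_on_def by blast
  then show ?thesis unfolding span_on_def
    by (intro exI[of _ "\<lambda>m. a * c m"]) (simp add: sum_distrib_left mult.assoc)
qed

lemma span_on_diff:
  assumes "span_on S \<phi> A f" "span_on S \<phi> A g"
  shows "span_on S \<phi> A (\<lambda>x. f x - g x)"
  using span_on_add[OF assms(1) span_on_scale[OF assms(2), of "-1"]] by simp

lemma span_on_sum:
  assumes "\<And>i. i \<in> I \<Longrightarrow> span_on S \<phi> A (f i)"
  shows "span_on S \<phi> A (\<lambda>x. \<Sum>i\<in>I. f i x)"
  using assms
proof (induction I rule: infinite_finite_induct)
  case (insert j I)
  have "span_on S \<phi> A (\<lambda>x. f j x + (\<Sum>i\<in>I. f i x))"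
    by (rule span_on_add) (use insert in auto)
  with insert show ?case by simp
qed (simp_all add: span_on_zero)

lemma span_on_superset:
  assumes "finite A" "m \<in> A"
  shows "span_on S \<phi> A (\<phi> m)"
  unfolding span_on_def
  by (rule exI[of _ "\<lambda>l. if l = m then 1 else 0"])
     (use assms in \<open>simp add: if_distrib[of "\<lambda>a. a * _"] cong: if_cong\<close>)

lemma span_on_trans:
  assumes "span_on S \<phi> A f" "\<And>m. m \<in> A \<Longrightarrow> span_on S \<psi> B (\<phi> m)"
  shows "span_on S \<psi> B f"
proof -
  obtain c where c: "\<forall>x\<in>S. f x = (\<Sum>m\<in>A. c m * \<phi> m x)"
    using assms(1) unfolding span_on_def by blast
  have "span_on S \<psi> B (\<lambda>x. \<Sum>m\<in>A. c m * \<phi> m x)"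
    by (intro span_on_sum span_on_scale assms(2))
  then show ?thesis using c by (subst span_on_cong[of S f "\<lambda>x. \<Sum>m\<in>A. c m * \<phi> m x"]) auto
qed

lemma span_on_mono:
  assumes "span_on S \<phi> A f" "A \<subseteq> B" "finite B"
  shows "span_on S \<phi> B f"
  using assms by (intro span_on_trans[OF assms(1)] span_on_superset) auto

text \<open>Linearity reduces multiplication by \<open>h\<close> to the generators. It is applied
  with \<open>h\<close> a coordinate, where \<open>B\<close> allows one degree more than
  \<open>A\<close>.\<close>

lemma span_on_mult_trans:
  assumes "span_on S \<phi> A f" "\<And>m. m \<in> A \<Longrightarrow> span_on S \<psi> B (\<lambda>x. h x * \<phi> m x)"
  shows "span_on S \<psi> B (\<lambda>x. h x * f x)"
proof -
  obtain c where c: "\<forall>x\<in>S. f x = (\<Sum>m\<in>A. c m * \<phi> m x)"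
    using assms(1) unfolding span_on_def by blast
  have "span_on S \<psi> B (\<lambda>x. \<Sum>m\<in>A. c m * (h x * \<phi> m x))"
    by (intro span_on_sum span_on_scale assms(2))
  then show ?thesis using c
    by (subst span_on_cong[of S _ "\<lambda>x. \<Sum>m\<in>A. c m * (h x * \<phi> m x)"])
       (auto simp: sum_distrib_left mult_ac)
qed

lemma finite_total_le [simp]: "finite {m :: 'b::finite \<Rightarrow> nat. total m \<le> k}"
proof -
  have "{m :: 'b \<Rightarrow> nat. total m \<le> k} = (\<Union>j\<le>k. {m. total m = j})" by auto
  then show ?thesis using finite_compositions[of "UNIV :: 'b set"] by simp
qed

lemma finite_total_eq [simp]: "finite {m :: 'b::finite \<Rightarrow> nat. total m = k}"
  using finite_compositions[of "UNIV :: 'b set"] by simp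

lemma prod_fun_upd:
  fixes F :: "'b::finite \<Rightarrow> nat \<Rightarrow> 'c::comm_monoid_mult"
  shows "(\<Prod>j\<in>UNIV. F j ((m(i := k)) j)) = F i k * (\<Prod>j\<in>UNIV - {i}. F j (m j))"
  by (subst prod.remove[of _ i]) (auto intro!: prod.cong)

lemma total_fun_upd_Suc: "total (m(i := Suc (m i))) = Suc (total (m :: 'b::finite \<Rightarrow> nat))"
  by (subst (1 2) sum.remove[of _ i]) (auto intro!: sum.cong)

lemma total_fun_upd_pred:
  assumes "m i > 0"
  shows "Suc (total (m(i := m i - 1))) = total (m :: 'b::finite \<Rightarrow> nat)"
  using total_fun_upd_Suc[of "m(i := m i - 1)" i] assms by simp

section \<open>Polynomials of bounded degree on a set of lattice points\<close>

lemma poly_le_on_span: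
  "poly_le_on S k f = span_on S (\<lambda>m x. \<Prod>i\<in>UNIV. real (x i) ^ m i) {m. total m \<le> k} f"
  unfolding poly_le_on_def span_on_def ..

lemma poly_le_on_mono: "poly_le_on S j f \<Longrightarrow> j \<le> k \<Longrightarrow> poly_le_on S k f"
  unfolding poly_le_on_span by (erule span_on_mono) auto

lemma poly_le_on_mult_coord:
  assumes "poly_le_on S k f"
  shows "poly_le_on S (Suc k) (\<lambda>x. real (x i) * f x)"
  unfolding poly_le_on_span
proof (rule span_on_mult_trans[OF assms[unfolded poly_le_on_span]])
  fix m :: "'a \<Rightarrow> nat" assume m: "m \<in> {m. total m \<le> k}"
  let ?m = "m(i := Suc (m i))"
  have "real (x i) * (\<Prod>j\<in>UNIV. real (x j) ^ m j) = (\<Prod>j\<in>UNIV. real (x j) ^ ?m j)" for x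
    using prod_fun_upd[of "\<lambda>j k. real (x j) ^ k" m i "Suc (m i)"]
    by (subst prod.remove[of _ i]) auto
  moreover have "span_on S (\<lambda>m x. \<Prod>i\<in>UNIV. real (x i) ^ m i) {m. total m \<le> Suc k}
     (\<lambda>x. \<Prod>j\<in>UNIV. real (x j) ^ ?m j)"
    using m total_fun_upd_Suc[of m i] by (intro span_on_superset) auto
  ultimately show "span_on S (\<lambda>m x. \<Prod>i\<in>UNIV. real (x i) ^ m i) {m. total m \<le> Suc k}
     (\<lambda>x. real (x i) * (\<Prod>j\<in>UNIV. real (x j) ^ m j))" by simp
qed

lemma poly_le_on_const: "poly_le_on S k (\<lambda>_. c)"
proof -
  have "span_on S (\<lambda>m x. \<Prod>i\<in>UNIV. real (x i) ^ m i) {m. total m \<le> k} (\<lambda>x. \<Prod>i\<in>UNIV. real (x i) ^ (\<lambda>_. 0) i)"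
    by (rule span_on_superset) auto
  from span_on_scale[OF this, of c] show ?thesis by (simp add: poly_le_on_span)
qed

text \<open>Every monomial arises from 1 by multiplying by one coordinate at a time, so a graded
  family that contains 1 and pays one degree per coordinate reaches all polynomials. The index type
  \<open>'b\<close> may differ from the coordinate type \<open>'a\<close>, as happens on the
  simplex.\<close>

lemma poly_le_on_imp_span_on:
  fixes \<phi> :: "('b::finite \<Rightarrow> nat) \<Rightarrow> ('a::finite \<Rightarrow> nat) \<Rightarrow> real"
  assumes one: "\<And>k. span_on S \<phi> {m. total m \<le> k} (\<lambda>_. 1)"
    and coord: "\<And>i k f. span_on S \<phi> {m. total m \<le> k} f \<Longrightarrow>
                  span_on S \<phi> {m. total m \<le> Suc k} (\<lambda>x. real (x i) * f x)"
    and "poly_le_on S k f"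
  shows "span_on S \<phi> {m. total m \<le> k} f"
proof (rule span_on_trans[OF assms(3)[unfolded poly_le_on_span]])
  have mon: "span_on S \<phi> {m. total m \<le> total l} (\<lambda>x. \<Prod>i\<in>UNIV. real (x i) ^ l i)" for l :: "'a \<Rightarrow> nat"
  proof (induction "total l" arbitrary: l)
    case 0
    then have "l = (\<lambda>_. 0)" by auto
    then show ?case using one[of 0] by simp
  next
    case (Suc t)
    then obtain i where i: "l i > 0"
      by (metis Zero_not_Suc gr0I sum.neutral)
    let ?l = "l(i := l i - 1)"
    have t: "t = total ?l" using total_fun_upd_pred[of l i] i Suc.hyps(2) by simp
    have "real (x i) * (\<Prod>j\<in>UNIV. real (x j) ^ ?l j) = (\<Prod>j\<in>UNIV. real (x j) ^ l j)" for x
      using prod_fun_upd[of "\<lambda>j k. real (x j) ^ k" l i "l i - 1"] i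
      by (subst (2) prod.remove[of _ i]) (auto simp: power_eq_if)
    moreover have "span_on S \<phi> {m. total m \<le> Suc t} (\<lambda>x. real (x i) * (\<Prod>j\<in>UNIV. real (x j) ^ ?l j))"
      unfolding t using Suc.hyps(1)[OF t] by (rule coord)
    ultimately show ?case using Suc.hyps(2) by simp
  qed
  fix l :: "'a \<Rightarrow> nat" assume l: "l \<in> {m. total m \<le> k}"
  show "span_on S \<phi> {m. total m \<le> k} (\<lambda>x. \<Prod>i\<in>UNIV. real (x i) ^ l i)"
    by (rule span_on_mono[OF mon]) (use l in auto)
qed

section \<open>Product bases from three-term recurrences\<close>

text \<open>The common property of falling factorials and Charlier polynomials. Since \<alpha> is
  nonzero, the recurrence can be solved for the next element; the condition on \<gamma> neutralises
  the truncated index \<open>n - 1\<close> at \<open>n = 0\<close>.\<close>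

definition three_term :: "(nat \<Rightarrow> nat \<Rightarrow> real) \<Rightarrow> bool" where
  "three_term g \<longleftrightarrow> (\<forall>x. g 0 x = 1) \<and>
     (\<forall>n. \<exists>\<alpha> \<beta> \<gamma>. \<alpha> \<noteq> 0 \<and> (n = 0 \<longrightarrow> \<gamma> = 0) \<and>
        (\<forall>x. real x * g n x = \<alpha> * g (Suc n) x + \<beta> * g n x + \<gamma> * g (n - 1) x))"

text \<open>The map \<open>h\<close> says which coordinate of the argument the factor
  \<open>i\<close> reads: \<open>id\<close> on the Poisson side, \<open>Some\<close> for the first d
  coordinates of a multinomial vector.\<close>

definition prod_basis ::
  "('b \<Rightarrow> 'a) \<Rightarrow> ('b::finite \<Rightarrow> nat \<Rightarrow> nat \<Rightarrow> real) \<Rightarrow> ('b \<Rightarrow> nat) \<Rightarrow> ('a \<Rightarrow> nat) \<Rightarrow> real" where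
  "prod_basis h g m x = (\<Prod>i\<in>UNIV. g i (m i) (x (h i)))"

lemma prod_basis_three_term:
  assumes "three_term (g i)"
  shows "\<exists>\<alpha> \<beta> \<gamma>. \<alpha> \<noteq> 0 \<and> (m i = 0 \<longrightarrow> \<gamma> = 0) \<and>
    (\<forall>x. real (x (h i)) * prod_basis h g m x = \<alpha> * prod_basis h g (m(i := Suc (m i))) x
        + \<beta> * prod_basis h g m x + \<gamma> * prod_basis h g (m(i := m i - 1)) x)"
proof -
  obtain \<alpha> \<beta> \<gamma> where abc: "\<alpha> \<noteq> 0" "m i = 0 \<Longrightarrow> \<gamma> = 0"
    "\<And>x. real x * g i (m i) x = \<alpha> * g i (Suc (m i)) x + \<beta> * g i (m i) x + \<gamma> * g i (m i - 1) x"
    using assms unfolding three_term_def by metis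
  have upd: "prod_basis h g (m(i := k)) x = g i k (x (h i)) * (\<Prod>j\<in>UNIV - {i}. g j (m j) (x (h j)))" for k x
    unfolding prod_basis_def by (rule prod_fun_upd[of "\<lambda>j k. g j k (x (h j))"])
  have "real (x (h i)) * prod_basis h g m x = \<alpha> * prod_basis h g (m(i := Suc (m i))) x
        + \<beta> * prod_basis h g m x + \<gamma> * prod_basis h g (m(i := m i - 1)) x" for x
    using upd[of "m i" x] by (simp add: upd mult.assoc[symmetric] abc(3) distrib_right)
  with abc(1,2) show ?thesis
    by (intro exI[of _ \<alpha>] exI[of _ \<beta>] exI[of _ \<gamma>] conjI allI impI)
qed

lemma span_on_prod_basis_one:
  assumes "\<And>i. three_term (g i)"
  shows "span_on S (prod_basis h g) {m. total m \<le> k} (\<lambda>_. 1)"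
proof -
  have "prod_basis h g (\<lambda>_. 0) x = 1" for x
    using assms by (simp add: prod_basis_def three_term_def)
  moreover have "span_on S (prod_basis h g) {m. total m \<le> k} (prod_basis h g (\<lambda>_. 0))"
    by (rule span_on_superset) auto
  ultimately show ?thesis by (simp cong: span_on_cong)
qed

lemma span_on_prod_basis_mult_coord:
  fixes g :: "'b::finite \<Rightarrow> nat \<Rightarrow> nat \<Rightarrow> real"
  assumes "\<And>i. three_term (g i)" "span_on S (prod_basis h g) {m. total m \<le> k} f"
  shows "span_on S (prod_basis h g) {m. total m \<le> Suc k} (\<lambda>x. real (x (h i)) * f x)"
  using assms(2)
proof (rule span_on_mult_trans)
  fix m :: "'b \<Rightarrow> nat" assume m: "m \<in> {m. total m \<le> k}"
  obtain \<alpha> \<beta> \<gamma> where abc: "m i = 0 \<Longrightarrow> \<gamma> = 0"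
    "\<And>x. real (x (h i)) * prod_basis h g m x = \<alpha> * prod_basis h g (m(i := Suc (m i))) x
        + \<beta> * prod_basis h g m x + \<gamma> * prod_basis h g (m(i := m i - 1)) x"
    using prod_basis_three_term[of g i m h, OF assms(1)] by auto
  \<comment> \<open>At \<open>m i = 0\<close> truncated subtraction leaves \<open>m\<close>
    unchanged, so the bound holds there as well.\<close>
  have "total (m(i := m i - 1)) \<le> Suc k"
    using m total_fun_upd_pred[of m i] by (cases "m i = 0") (auto simp: fun_upd_idem)
  then have "span_on S (prod_basis h g) {m. total m \<le> Suc k} (prod_basis h g l)"
    if "l \<in> {m(i := Suc (m i)), m, m(i := m i - 1)}" for l
    using that m total_fun_upd_Suc[of m i] by (intro span_on_superset) auto
  then show "span_on S (prod_basis h g) {m. total m \<le> Suc k} (\<lambda>x. real (x (h i)) * prod_basis h g m x)"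
    unfolding abc(2) by (intro span_on_add span_on_scale) blast+
qed

text \<open>The recurrence is solved for its top element, which becomes a coordinate times an
  element one degree lower, plus elements of lower degree. It reaches two degrees down, hence the
  strong induction.\<close>

lemma poly_le_on_prod_basis:
  assumes "\<And>i. three_term (g i)"
  shows "poly_le_on S (total m) (prod_basis h g m)"
proof (induction "total m" arbitrary: m rule: less_induct)
  case less
  show ?case
  proof (cases "total m = 0")
    case True
    then have "m = (\<lambda>_. 0)" by auto
    then have "prod_basis h g m = (\<lambda>_. 1)"
      using assms by (simp add: prod_basis_def three_term_def fun_eq_iff)
    then show ?thesis by (simp add: poly_le_on_const)
  next
    case False
    then obtain i where i: "m i > 0"
      by (metis gr0I sum.neutral)
    define l where "l = m(i := m i - 1)"
    have m: "m = l(i := Suc (l i))" using i by (auto simp: l_def)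
    have tl: "total m = Suc (total l)" unfolding m by (rule total_fun_upd_Suc)
    obtain \<alpha> \<beta> \<gamma> where abc: "\<alpha> \<noteq> 0" "l i = 0 \<Longrightarrow> \<gamma> = 0"
      and rec: "\<And>x. real (x (h i)) * prod_basis h g l x = \<alpha> * prod_basis h g (l(i := Suc (l i))) x
          + \<beta> * prod_basis h g l x + \<gamma> * prod_basis h g (l(i := l i - 1)) x"
      using prod_basis_three_term[of g i l h, OF assms] by auto
    have pl: "poly_le_on S (total l) (prod_basis h g l)" by (rule less) (simp add: tl)
    have pl2: "poly_le_on S (total m) (\<lambda>x. \<gamma> * prod_basis h g (l(i := l i - 1)) x)"
    proof (cases "l i = 0")
      case True then show ?thesis using abc(2) by (simp add: poly_le_on_const)
    next
      case False
      then have "Suc (total (l(i := l i - 1))) = total l" by (intro total_fun_upd_pred) simp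
      then have "poly_le_on S (total m) (prod_basis h g (l(i := l i - 1)))"
        by (intro poly_le_on_mono[OF less]) (auto simp: tl)
      then show ?thesis unfolding poly_le_on_span by (rule span_on_scale)
    qed
    have "prod_basis h g m x = (1/\<alpha>) * ((real (x (h i)) * prod_basis h g l x - \<beta> * prod_basis h g l x)
        - \<gamma> * prod_basis h g (l(i := l i - 1)) x)" for x
      using abc(1) rec[of x, folded m] by (simp add: field_simps)
    moreover have "poly_le_on S (total m) (\<lambda>x. (1/\<alpha>) * ((real (x (h i)) * prod_basis h g l x - \<beta> * prod_basis h g l x)
        - \<gamma> * prod_basis h g (l(i := l i - 1)) x))"
      using poly_le_on_mult_coord[OF pl, of "h i"] pl2 poly_le_on_mono[OF pl, of "total m"]
      unfolding poly_le_on_span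
      by (intro span_on_scale) (rule span_on_diff[OF span_on_diff[OF _ span_on_scale]], auto simp: tl)
    ultimately show ?thesis by (simp add: poly_le_on_span cong: span_on_cong)
  qed
qed

lemma poly_le_on_imp_span_on_prod_basis:
  assumes "\<And>i. three_term (g i)" "poly_le_on S k f"
  shows "span_on S (prod_basis id g) {m. total m \<le> k} f"
  by (rule poly_le_on_imp_span_on[OF _ _ assms(2)])
     (use span_on_prod_basis_one[OF assms(1)] span_on_prod_basis_mult_coord[OF assms(1), where h = id] in auto)

text \<open>Only multiplication by the last coordinate is new: on the simplex it equals N minus the
  sum of the others, so it acts as a combination of multiplications that are already
  understood.\<close>

lemma poly_le_on_simplex_imp_span_on_prod_basis:
  fixes g :: "'d::finite \<Rightarrow> nat \<Rightarrow> nat \<Rightarrow> real"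
  assumes "\<And>i. three_term (g i)" and S: "\<And>x. x \<in> S \<Longrightarrow> total x = N" and "poly_le_on S k f"
  shows "span_on S (prod_basis Some g) {m. total m \<le> k} f"
proof (rule poly_le_on_imp_span_on[OF _ _ assms(3)])
  fix j and k and f :: "('d option \<Rightarrow> nat) \<Rightarrow> real"
  assume f: "span_on S (prod_basis Some g) {m. total m \<le> k} f"
  have some: "span_on S (prod_basis Some g) {m. total m \<le> Suc k} (\<lambda>x. real (x (Some i)) * f x)" for i
    by (rule span_on_prod_basis_mult_coord[OF assms(1) f])
  show "span_on S (prod_basis Some g) {m. total m \<le> Suc k} (\<lambda>x. real (x j) * f x)"
  proof (cases j)
    case (Some i) then show ?thesis using some by simp
  next
    case None
    have "real (x None) * f x = real N * f x - (\<Sum>i\<in>UNIV. real (x (Some i)) * f x)" if "x \<in> S" for x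
    proof -
      have "real N = real (x None) + (\<Sum>i\<in>UNIV. real (x (Some i)))"
        using S[OF that] by (auto simp: UNIV_option_conv sum.reindex)
      then show ?thesis by (simp add: sum_distrib_right[symmetric] ring_distribs)
    qed
    moreover have "span_on S (prod_basis Some g) {m. total m \<le> Suc k}
        (\<lambda>x. real N * f x - (\<Sum>i\<in>UNIV. real (x (Some i)) * f x))"
      by (intro span_on_diff span_on_scale span_on_sum some span_on_mono[OF f]) auto
    ultimately show ?thesis using None by (simp cong: span_on_cong)
  qed
qed (use span_on_prod_basis_one[OF assms(1)] in auto)

subsection \<open>Orthonormal polynomials and their kernels\<close>

lemma integrable_mult_of_integrable_squares:
  fixes f g :: "'a \<Rightarrow> real" and P :: "'a pmf"
  assumes "integrable P (\<lambda>x. f x * f x)" "integrable P (\<lambda>x. g x * g x)"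
  shows "integrable P (\<lambda>x. f x * g x)"
proof (rule Bochner_Integration.integrable_bound[OF Bochner_Integration.integrable_add[OF assms]])
  have "\<bar>f x * g x\<bar> \<le> f x * f x + g x * g x" for x
  proof -
    have "2 * \<bar>f x\<bar> * \<bar>g x\<bar> \<le> \<bar>f x\<bar>\<^sup>2 + \<bar>g x\<bar>\<^sup>2" by (rule sum_squares_bound)
    then have "2 * \<bar>f x * g x\<bar> \<le> f x * f x + g x * g x"
      by (simp only: power2_abs power2_eq_square abs_mult mult.assoc)
    then show ?thesis by simp
  qed
  then show "AE x in P. norm (f x * g x) \<le> norm (f x * f x + g x * g x)"
    by (intro AE_I2) (auto intro: order_trans)
qed auto

definition orthonormal_on :: "'a pmf \<Rightarrow> 'b set \<Rightarrow> ('b \<Rightarrow> 'a \<Rightarrow> real) \<Rightarrow> bool" where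
  "orthonormal_on P I Q \<longleftrightarrow>
     (\<forall>m\<in>I. \<forall>n\<in>I. measure_pmf.expectation P (\<lambda>x. Q m x * Q n x) = (if m = n then 1 else 0))"

lemma orthonormal_onD:
  "orthonormal_on P I Q \<Longrightarrow> m \<in> I \<Longrightarrow> n \<in> I \<Longrightarrow>
     measure_pmf.expectation P (\<lambda>x. Q m x * Q n x) = (if m = n then 1 else 0)"
  unfolding orthonormal_on_def by blast

lemma orthonormal_on_subset: "orthonormal_on P I Q \<Longrightarrow> J \<subseteq> I \<Longrightarrow> orthonormal_on P J Q"
  unfolding orthonormal_on_def by blast

lemma orthonormal_on_integrable:
  assumes "orthonormal_on P I Q" "m \<in> I" "n \<in> I"
  shows "integrable P (\<lambda>x. Q m x * Q n x)"
proof -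
  have sq: "integrable P (\<lambda>x. Q l x * Q l x)" if "l \<in> I" for l
  proof (rule ccontr)
    assume "\<not> integrable P (\<lambda>x. Q l x * Q l x)"
    then have "measure_pmf.expectation P (\<lambda>x. Q l x * Q l x) = 0" by (rule not_integrable_integral_eq)
    then show False using orthonormal_onD[OF assms(1) that that] by simp
  qed
  show ?thesis by (rule integrable_mult_of_integrable_squares[OF sq[OF assms(2)] sq[OF assms(3)]])
qed

lemma expectation_sum_mult_orthonormal:
  assumes Q: "orthonormal_on P A Q" and "finite A" "n \<in> A"
    and f: "\<And>x. x \<in> set_pmf P \<Longrightarrow> f x = (\<Sum>m\<in>A. c m * Q m x)"
  shows "measure_pmf.expectation P (\<lambda>x. f x * Q n x) = c n"
proof -
  have "measure_pmf.expectation P (\<lambda>x. f x * Q n x)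
      = measure_pmf.expectation P (\<lambda>x. \<Sum>m\<in>A. c m * (Q m x * Q n x))"
    by (intro integral_cong_AE) (auto simp: AE_measure_pmf_iff f sum_distrib_right mult.assoc)
  also have "\<dots> = (\<Sum>m\<in>A. c m * measure_pmf.expectation P (\<lambda>x. Q m x * Q n x))"
    using orthonormal_on_integrable[OF Q] assms(3)
    by (subst Bochner_Integration.integral_sum) auto
  also have "\<dots> = (\<Sum>m\<in>A. c m * (if m = n then 1 else 0))"
    by (intro sum.cong) (simp_all add: orthonormal_onD[OF Q _ assms(3)])
  also have "\<dots> = c n" using assms(2,3) by (simp add: if_distrib cong: if_cong)
  finally show ?thesis .
qed

lemma span_on_orthonormal_expansion:
  assumes Q: "orthonormal_on P A Q" and "finite A" and f: "span_on (set_pmf P) Q A f" and "x \<in> set_pmf P"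
  shows "f x = (\<Sum>m\<in>A. measure_pmf.expectation P (\<lambda>x. f x * Q m x) * Q m x)"
proof -
  obtain c where c: "\<And>x. x \<in> set_pmf P \<Longrightarrow> f x = (\<Sum>m\<in>A. c m * Q m x)"
    using f unfolding span_on_def by blast
  show ?thesis
    using c[OF assms(4)] expectation_sum_mult_orthonormal[OF Q assms(2) _ c] by simp
qed

text \<open>Expanding \<open>Q m\<close> in \<open>R\<close> at x and \<open>R l\<close> in
  \<open>Q\<close> at y uses the same numbers \<open>?E m l\<close>, so both kernels are one double
  sum read in two orders. The expansions hold on the support only, which is why x and y must lie
  there.\<close>

lemma orthonormal_kernel_unique:
  assumes Q: "orthonormal_on P A Q" "finite A" and R: "orthonormal_on P B R" "finite B"
    and QR: "\<And>m. m \<in> A \<Longrightarrow> span_on (set_pmf P) R B (Q m)"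
    and RQ: "\<And>m. m \<in> B \<Longrightarrow> span_on (set_pmf P) Q A (R m)"
    and xy: "x \<in> set_pmf P" "y \<in> set_pmf P"
  shows "(\<Sum>m\<in>A. Q m x * Q m y) = (\<Sum>m\<in>B. R m x * R m y)"
proof -
  let ?E = "\<lambda>m l. measure_pmf.expectation P (\<lambda>x. Q m x * R l x)"
  have 1: "Q m x = (\<Sum>l\<in>B. ?E m l * R l x)" if "m \<in> A" for m
    by (rule span_on_orthonormal_expansion[OF R QR[OF that] xy(1)])
  have 2: "R l y = (\<Sum>m\<in>A. ?E m l * Q m y)" if "l \<in> B" for l
    using span_on_orthonormal_expansion[OF Q RQ[OF that] xy(2)] by (simp add: mult.commute)
  have "(\<Sum>m\<in>A. Q m x * Q m y) = (\<Sum>m\<in>A. \<Sum>l\<in>B. R l x * (?E m l * Q m y))"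
    by (simp add: 1 sum_distrib_left mult_ac)
  also have "\<dots> = (\<Sum>l\<in>B. \<Sum>m\<in>A. R l x * (?E m l * Q m y))" by (rule sum.swap)
  also have "\<dots> = (\<Sum>l\<in>B. R l x * R l y)" by (simp add: 2 sum_distrib_left)
  finally show ?thesis .
qed

lemma finite_index_le [simp]: "finite {m :: 'b::finite \<Rightarrow> nat. m \<in> I \<and> total m \<le> k}"
  by (rule finite_subset[OF _ finite_total_le[of k]]) auto

lemma finite_index_eq [simp]: "finite {m :: 'b::finite \<Rightarrow> nat. m \<in> I \<and> total m = k}"
  by (rule finite_subset[OF _ finite_total_le[of k]]) auto

lemma complete_orthonormal_span_on:
  "complete_orthonormal P I Q \<Longrightarrow> poly_le_on (set_pmf P) k f \<Longrightarrow>
     span_on (set_pmf P) Q {m. m \<in> I \<and> total m \<le> k} f"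
  unfolding complete_orthonormal_def span_on_def by blast

lemma complete_orthonormal_orthonormal_on:
  "complete_orthonormal P I Q \<Longrightarrow> orthonormal_on P I Q"
  unfolding complete_orthonormal_def orthonormal_on_def by blast

lemma complete_orthonormal_poly_le_on:
  "complete_orthonormal P I Q \<Longrightarrow> m \<in> I \<Longrightarrow> poly_le_on (set_pmf P) (total m) (Q m)"
  unfolding complete_orthonormal_def poly_degree_on_def by blast

text \<open>The lower bound on the degree is automatic: a \<open>Q m\<close> of smaller degree would
  be a combination of other members of the orthonormal set, against its norm being 1.\<close>

lemma complete_orthonormalI:
  assumes Q: "orthonormal_on P I Q"
    and le: "\<And>m. m \<in> I \<Longrightarrow> poly_le_on (set_pmf P) (total m) (Q m)"
    and span: "\<And>k f. poly_le_on (set_pmf P) k f \<Longrightarrow> span_on (set_pmf P) Q {m. m \<in> I \<and> total m \<le> k} f"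
  shows "complete_orthonormal P I Q"
proof -
  have "\<not> poly_le_on (set_pmf P) j (Q m)" if m: "m \<in> I" "j < total m" for m j
  proof
    assume "poly_le_on (set_pmf P) j (Q m)"
    then obtain c where "\<forall>x\<in>set_pmf P. Q m x = (\<Sum>n | n \<in> I \<and> total n \<le> j. c n * Q n x)"
      using span unfolding span_on_def by blast
    \<comment> \<open>The index m enters with coefficient 0, so that the coefficient formula reads
      off E[Q m * Q m] = 0.\<close>
    then have *: "Q m x = (\<Sum>n \<in> insert m {n. n \<in> I \<and> total n \<le> j}. (c(m := 0)) n * Q n x)"
      if "x \<in> set_pmf P" for x
      using that m by (subst sum.insert) (auto intro!: sum.cong)
    have "measure_pmf.expectation P (\<lambda>x. Q m x * Q m x) = (c(m := 0)) m"
      by (rule expectation_sum_mult_orthonormal[OF orthonormal_on_subset[OF Q] _ _ *]) (use m in auto)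
    then show False using orthonormal_onD[OF Q m(1) m(1)] by simp
  qed
  then show ?thesis
    using assms unfolding complete_orthonormal_def poly_degree_on_def orthonormal_on_def span_on_def by blast
qed

lemma complete_orthonormal_cumulative_kernel_unique:
  assumes Q: "complete_orthonormal P I Q" and R: "complete_orthonormal P I R"
    and "x \<in> set_pmf P" "y \<in> set_pmf P"
  shows "(\<Sum>m | m \<in> I \<and> total m \<le> n. Q m x * Q m y) = (\<Sum>m | m \<in> I \<and> total m \<le> n. R m x * R m y)"
  using assms
  by (intro orthonormal_kernel_unique[of P])
     (auto intro!: complete_orthonormal_span_on intro: poly_le_on_mono complete_orthonormal_poly_le_on
         orthonormal_on_subset[OF complete_orthonormal_orthonormal_on])

text \<open>Completeness speaks of degree at most k, so change-of-basis arguments yield cumulative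
  sums; this identity transfers them to a single degree. The case \<open>n = 0\<close> is separate
  because \<open>n - 1\<close> truncates.\<close>

lemma kernel_eq_diff_cumulative:
  fixes f :: "('b::finite \<Rightarrow> nat) \<Rightarrow> real"
  shows "(\<Sum>m | m \<in> I \<and> total m = n. f m) = (\<Sum>m | m \<in> I \<and> total m \<le> n. f m)
     - (if n = 0 then 0 else (\<Sum>m | m \<in> I \<and> total m \<le> n - 1. f m))"
proof (cases n)
  case (Suc k)
  have "{m. m \<in> I \<and> total m \<le> n} = {m. m \<in> I \<and> total m = n} \<union> {m. m \<in> I \<and> total m \<le> k}"
    using Suc by auto
  then have "(\<Sum>m | m \<in> I \<and> total m \<le> n. f m)
      = (\<Sum>m | m \<in> I \<and> total m = n. f m) + (\<Sum>m | m \<in> I \<and> total m \<le> k. f m)"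
    using Suc by (subst sum.union_disjoint[symmetric]) auto
  then show ?thesis using Suc by simp
qed simp

lemma reproducing_kernel_eq:
  assumes Q: "complete_orthonormal P I Q" and "x \<in> set_pmf P" "y \<in> set_pmf P"
  shows "reproducing_kernel P I n x y = (\<Sum>m | m \<in> I \<and> total m = n. Q m x * Q m y)"
  unfolding reproducing_kernel_def
proof (rule the_equality)
  fix v assume "\<exists>Q. complete_orthonormal P I Q \<and> v = (\<Sum>m | m \<in> I \<and> total m = n. Q m x * Q m y)"
  then obtain R where R: "complete_orthonormal P I R" "v = (\<Sum>m | m \<in> I \<and> total m = n. R m x * R m y)"
    by blast
  show "v = (\<Sum>m | m \<in> I \<and> total m = n. Q m x * Q m y)"
    unfolding R(2) kernel_eq_diff_cumulative[where I = I and n = n]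
      complete_orthonormal_cumulative_kernel_unique[OF R(1) Q assms(2,3)] ..
qed (use Q in blast)

section \<open>Gram-Schmidt orthogonalisation on a finite support\<close>

text \<open>The rank \<open>r\<close> plays the role of the degree. Elements are added by
  nondecreasing rank, so each new one only needs those of rank at most its own, and the two families
  span the same spaces at every rank. Finiteness of the support makes every function
  integrable.\<close>

lemma gram_schmidt:
  fixes P :: "'a pmf" and \<phi> :: "'b \<Rightarrow> 'a \<Rightarrow> real" and r :: "'b \<Rightarrow> nat"
  assumes fin: "finite (set_pmf P)" and "finite J"
    and "\<And>c. (\<And>x. x \<in> set_pmf P \<Longrightarrow> (\<Sum>m\<in>J. c m * \<phi> m x) = 0) \<Longrightarrow> \<forall>m\<in>J. c m = 0"
  shows "\<exists>Q. orthonormal_on P J Q \<and>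
    (\<forall>m\<in>J. span_on (set_pmf P) \<phi> {l\<in>J. r l \<le> r m} (Q m) \<and> span_on (set_pmf P) Q {l\<in>J. r l \<le> r m} (\<phi> m))"
  using assms(2,3)
proof (induction J rule: finite_ranking_induct[where f = r])
  case empty
  then show ?case by (simp add: orthonormal_on_def)
next
  case (insert a J)
  note int [simp] = integrable_measure_pmf_finite[OF fin]
  let ?S = "set_pmf P" and ?E = "measure_pmf.expectation P"
  show ?case
  \<comment> \<open>The ranking induction does not promise that \<open>a\<close> is new.\<close>
  proof (cases "a \<in> J")
    case True
    then show ?thesis using insert.IH insert.prems by (simp add: insert_absorb)
  next
    case False
    have indep: "\<forall>m\<in>J. c m = 0" if "\<And>x. x \<in> ?S \<Longrightarrow> (\<Sum>m\<in>J. c m * \<phi> m x) = 0" for c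
    proof -
      have "(\<Sum>m\<in>insert a J. (c(a := 0)) m * \<phi> m x) = 0" if "x \<in> ?S" for x
      proof -
        have "(\<Sum>m\<in>J. (c(a := 0)) m * \<phi> m x) = (\<Sum>m\<in>J. c m * \<phi> m x)"
          using False by (intro sum.cong) auto
        then show ?thesis using insert.hyps(1) False \<open>\<And>x. x \<in> ?S \<Longrightarrow> (\<Sum>m\<in>J. c m * \<phi> m x) = 0\<close>[OF that] by simp
      qed
      from insert.prems[OF this] show ?thesis using False by (auto split: if_splits)
    qed
    from insert.IH[OF this] obtain Q where Q: "orthonormal_on P J Q"
      and Q\<phi>: "\<And>m. m \<in> J \<Longrightarrow> span_on ?S \<phi> {l\<in>J. r l \<le> r m} (Q m)"
      and \<phi>Q: "\<And>m. m \<in> J \<Longrightarrow> span_on ?S Q {l\<in>J. r l \<le> r m} (\<phi> m)" by blast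
    define u where "u = (\<lambda>x. \<phi> a x - (\<Sum>m\<in>J. ?E (\<lambda>x. \<phi> a x * Q m x) * Q m x))"
    have u_orth: "?E (\<lambda>x. u x * Q n x) = 0" if n: "n \<in> J" for n
    proof -
      have "?E (\<lambda>x. u x * Q n x) = ?E (\<lambda>x. \<phi> a x * Q n x)
          - ?E (\<lambda>x. (\<Sum>m\<in>J. ?E (\<lambda>x. \<phi> a x * Q m x) * Q m x) * Q n x)"
        unfolding u_def left_diff_distrib by (rule Bochner_Integration.integral_diff) simp_all
      also have "?E (\<lambda>x. (\<Sum>m\<in>J. ?E (\<lambda>x. \<phi> a x * Q m x) * Q m x) * Q n x) = ?E (\<lambda>x. \<phi> a x * Q n x)"
        by (rule expectation_sum_mult_orthonormal[OF Q insert.hyps(1) n]) simp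
      finally show ?thesis by simp
    qed
    have Q\<phi>': "span_on ?S \<phi> J (Q m)" if "m \<in> J" for m
      by (rule span_on_mono[OF Q\<phi>[OF that]]) (use insert.hyps in auto)
    have u_span: "span_on ?S \<phi> (insert a J) u"
      unfolding u_def
      by (intro span_on_diff span_on_sum span_on_scale)
         (use insert.hyps in \<open>auto intro: span_on_mono[OF Q\<phi>'] span_on_superset\<close>)
    \<comment> \<open>If the residual \<open>u\<close> had norm zero, it would vanish on the support
      and \<phi> a would be a combination of the earlier elements; giving \<phi> a the coefficient
      -1 then yields a relation that independence forbids.\<close>
    have u_sq: "?E (\<lambda>x. u x * u x) > 0"
    proof (rule ccontr)
      assume "\<not> ?E (\<lambda>x. u x * u x) > 0"
      then have "?E (\<lambda>x. u x * u x) = 0"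
        by (intro antisym Bochner_Integration.integral_nonneg) auto
      then have "AE x in P. u x * u x = 0"
        by (subst (asm) integral_nonneg_eq_0_iff_AE) auto
      then have u0: "\<And>x. x \<in> ?S \<Longrightarrow> u x = 0" by (simp add: AE_measure_pmf_iff)
      have "span_on ?S \<phi> J (\<lambda>x. \<Sum>m\<in>J. ?E (\<lambda>x. \<phi> a x * Q m x) * Q m x)"
        by (intro span_on_sum span_on_scale Q\<phi>')
      then obtain c where c: "\<And>x. x \<in> ?S \<Longrightarrow> \<phi> a x = (\<Sum>m\<in>J. c m * \<phi> m x)"
        using u0 unfolding span_on_def u_def by fastforce
      have "(\<Sum>m\<in>insert a J. (c(a := -1)) m * \<phi> m x) = 0" if "x \<in> ?S" for x
      proof -
        have "(\<Sum>m\<in>J. (c(a := -1)) m * \<phi> m x) = (\<Sum>m\<in>J. c m * \<phi> m x)"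
          using False by (intro sum.cong) auto
        then show ?thesis using insert.hyps(1) False c[OF that] by simp
      qed
      from insert.prems[OF this] show False by simp
    qed
    define w where "w = sqrt (?E (\<lambda>x. u x * u x))"
    have w: "w > 0" "w * w = ?E (\<lambda>x. u x * u x)" using u_sq by (simp_all add: w_def)
    define R where "R = Q(a := \<lambda>x. (1 / w) * u x)"
    have R_a: "R a = (\<lambda>x. (1 / w) * u x)" and R_J: "\<And>m. m \<in> J \<Longrightarrow> R m = Q m"
      using False by (auto simp: R_def)
    have Ru: "?E (\<lambda>x. R a x * Q n x) = 0" if "n \<in> J" for n
      using u_orth[OF that] by (simp add: R_a)
    then have uR: "?E (\<lambda>x. Q n x * R a x) = 0" if "n \<in> J" for n
      using that by (simp add: mult.commute)
    have "?E (\<lambda>x. R a x * R a x) = ?E (\<lambda>x. (1 / (w * w)) * (u x * u x))"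
      by (simp add: R_a)
    also have "\<dots> = (1 / (w * w)) * ?E (\<lambda>x. u x * u x)"
      by (rule integral_mult_right_zero)
    also have "\<dots> = 1" using w u_sq by simp
    finally have RR: "?E (\<lambda>x. R a x * R a x) = 1" .
    have "orthonormal_on P (insert a J) R"
      unfolding orthonormal_on_def
    proof (intro ballI)
      fix m n assume "m \<in> insert a J" "n \<in> insert a J"
      then show "?E (\<lambda>x. R m x * R n x) = (if m = n then 1 else 0)"
        using RR Ru[of n] uR[of m] orthonormal_onD[OF Q, of m n] False
        by (cases "m = a"; cases "n = a") (simp_all add: R_J)
    qed
    moreover have "span_on ?S \<phi> {l\<in>insert a J. r l \<le> r m} (R m) \<and> span_on ?S R {l\<in>insert a J. r l \<le> r m} (\<phi> m)"
      if m: "m \<in> insert a J" for m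
    proof (cases "m = a")
      case True
      have all: "{l\<in>insert a J. r l \<le> r m} = insert a J" using insert.hyps(2) True by auto
      have eq: "\<phi> a = (\<lambda>x. w * R a x + (\<Sum>m\<in>J. ?E (\<lambda>x. \<phi> a x * Q m x) * R m x))"
        using w(1) by (intro ext) (simp add: R_a R_J u_def)
      have "span_on ?S R (insert a J) (\<lambda>x. w * R a x + (\<Sum>m\<in>J. ?E (\<lambda>x. \<phi> a x * Q m x) * R m x))"
        using insert.hyps(1) by (intro span_on_add span_on_sum span_on_scale span_on_superset) auto
      then have "span_on ?S R (insert a J) (\<phi> a)" by (subst eq)
      moreover have "span_on ?S \<phi> (insert a J) (R a)"
        unfolding R_a by (rule span_on_scale[OF u_span])
      ultimately show ?thesis unfolding all unfolding True by blast
    next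
      case False
      then have mJ: "m \<in> J" using m by simp
      have "span_on ?S R {l\<in>J. r l \<le> r m} (\<phi> m)"
        using \<phi>Q[OF mJ] by (subst span_on_cong_basis[of _ _ R Q]) (auto simp: R_J)
      then show ?thesis using Q\<phi>[OF mJ] insert.hyps(1)
        unfolding R_J[OF mJ] by (intro conjI) (rule span_on_mono, assumption, auto)+
    qed
    ultimately show ?thesis by blast
  qed
qed

section \<open>Falling factorials and orthonormal polynomials on the simplex\<close>

lemma falling_Suc: "falling x (Suc k) = (real x - real k) * falling x k"
  by (simp add: falling_def)

lemma falling_pos: "k \<le> x \<Longrightarrow> falling x k > 0"
  unfolding falling_def by (rule prod_pos) auto

lemma falling_eq_0: "x < k \<Longrightarrow> falling x k = 0"
  unfolding falling_def by (rule prod_zero) auto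

lemma three_term_falling: "three_term (\<lambda>n x. falling x n)"
  unfolding three_term_def
proof (intro conjI allI)
  fix n
  show "\<exists>\<alpha> \<beta> \<gamma>. \<alpha> \<noteq> 0 \<and> (n = 0 \<longrightarrow> \<gamma> = 0) \<and>
    (\<forall>x. real x * falling x n = \<alpha> * falling x (Suc n) + \<beta> * falling x n + \<gamma> * falling x (n - 1))"
    by (intro exI[of _ 1] exI[of _ "real n"] exI[of _ 0]) (simp add: falling_Suc algebra_simps)
qed (simp add: falling_def)

text \<open>Falling factorials are chosen because they vanish at small integers: this makes
  evaluation at lattice points triangular and kills, on the simplex, every element of degree above
  N.\<close>

abbreviation simplex_basis :: "('d::finite \<Rightarrow> nat) \<Rightarrow> ('d option \<Rightarrow> nat) \<Rightarrow> real" where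
  "simplex_basis \<equiv> prod_basis Some (\<lambda>_ n x. falling x n)"

lemma simplex_basis_eq_0:
  assumes "x (Some i) < m i"
  shows "simplex_basis m x = 0"
  unfolding prod_basis_def using assms by (intro prod_zero) (auto intro!: falling_eq_0)

lemma total_option: "total (x :: 'd::finite option \<Rightarrow> nat) = x None + total (\<lambda>i. x (Some i))"
  by (simp add: UNIV_option_conv sum.reindex)

lemma total_append_last: "total (append_last (x :: 'd::finite \<Rightarrow> 'b::comm_monoid_add) a) = total x + a"
  by (simp add: UNIV_option_conv sum.reindex append_last_def add.commute)

text \<open>Evaluate the relation at the lattice point m, completed to total N. An index l that is
  not below m contributes 0 by vanishing; one strictly below m has smaller degree, so its
  coefficient is already 0. Only \<open>c m\<close> times a positive value remains.\<close>

lemma simplex_basis_independent: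
  fixes c :: "('d::finite \<Rightarrow> nat) \<Rightarrow> real"
  assumes "\<And>x. total x = N \<Longrightarrow> (\<Sum>m | total m \<le> N. c m * simplex_basis m x) = 0"
    and "total m \<le> N"
  shows "c m = 0"
  using assms(2)
proof (induction "total m" arbitrary: m rule: less_induct)
  case less
  let ?x = "append_last m (N - total m)"
  have "c l * simplex_basis l ?x = 0" if l: "l \<noteq> m" "total l \<le> N" for l
  proof (cases "l \<le> m")
    case True
    with l(1) obtain i where "l i < m i"
      by (metis le_fun_def antisym linorder_not_less)
    then have "total l < total m"
      using True by (intro sum_strict_mono_ex1) (auto simp: le_fun_def)
    then show ?thesis using less.hyps[of l] l by simp
  next
    case False
    then obtain i where "m i < l i" by (auto simp: le_fun_def not_le)
    then have "simplex_basis l ?x = 0"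
      by (intro simplex_basis_eq_0[where i = i]) (auto simp: append_last_def)
    then show ?thesis by simp
  qed
  then have "(\<Sum>l | total l \<le> N. c l * simplex_basis l ?x) = (\<Sum>l\<in>{m}. c l * simplex_basis l ?x)"
    using less.prems by (intro sum.mono_neutral_right) auto
  moreover have "total ?x = N" using less.prems by (simp add: total_append_last)
  ultimately have "c m * simplex_basis m ?x = 0" using assms(1)[of ?x] by simp
  moreover have "simplex_basis m ?x > 0"
    unfolding prod_basis_def by (intro prod_pos) (auto simp: append_last_def falling_pos)
  ultimately show ?case by simp
qed

lemma complete_orthonormal_simplex_exists:
  fixes P :: "('d::finite option \<Rightarrow> nat) pmf"
  assumes supp: "set_pmf P = {x. total x = N}"
  shows "\<exists>Q. complete_orthonormal P {m :: 'd \<Rightarrow> nat. total m \<le> N} Q"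
proof -
  let ?J = "{m :: 'd \<Rightarrow> nat. total m \<le> N}"
  have fin: "finite (set_pmf P)" unfolding supp by simp
  have "\<exists>Q. orthonormal_on P ?J Q \<and> (\<forall>m\<in>?J. span_on (set_pmf P) simplex_basis {l\<in>?J. total l \<le> total m} (Q m)
        \<and> span_on (set_pmf P) Q {l\<in>?J. total l \<le> total m} (simplex_basis m))"
    by (rule gram_schmidt[OF fin]) (use simplex_basis_independent in \<open>auto simp: supp\<close>)
  then obtain Q where Q: "orthonormal_on P ?J Q"
    "\<And>m. m \<in> ?J \<Longrightarrow> span_on (set_pmf P) simplex_basis {l\<in>?J. total l \<le> total m} (Q m)"
    "\<And>m. m \<in> ?J \<Longrightarrow> span_on (set_pmf P) Q {l\<in>?J. total l \<le> total m} (simplex_basis m)" by blast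
  have "complete_orthonormal P ?J Q"
  proof (rule complete_orthonormalI[OF Q(1)])
    fix m assume "m \<in> ?J"
    from Q(2)[OF this] show "poly_le_on (set_pmf P) (total m) (Q m)"
      unfolding poly_le_on_span
      by (rule span_on_trans)
         (auto simp flip: poly_le_on_span intro!: poly_le_on_mono[OF poly_le_on_prod_basis] three_term_falling)
  next
    fix k f assume "poly_le_on (set_pmf P) k f"
    then have "span_on (set_pmf P) simplex_basis {m. total m \<le> k} f"
      by (intro poly_le_on_simplex_imp_span_on_prod_basis[where N = N] three_term_falling) (auto simp: supp)
    then show "span_on (set_pmf P) Q {m. m \<in> ?J \<and> total m \<le> k} f"
    proof (rule span_on_trans)
      fix m :: "'d \<Rightarrow> nat" assume m: "m \<in> {m. total m \<le> k}"
      show "span_on (set_pmf P) Q {m. m \<in> ?J \<and> total m \<le> k} (simplex_basis m)"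
      proof (cases "total m \<le> N")
        case True
        show ?thesis by (rule span_on_mono[OF Q(3)]) (use True m in auto)
      next
        \<comment> \<open>Degrees above N must be discarded, since the index set stops at N. The
          first d coordinates sum to at most N, so one of them is smaller than its index and the
          basis element vanishes on the support.\<close>
        case False
        have "simplex_basis m x = 0" if "x \<in> set_pmf P" for x
        proof -
          have "total (\<lambda>i. x (Some i)) < total m"
            using that False by (simp add: supp total_option)
          then obtain i where "x (Some i) < m i"
            by (metis leD not_le_imp_less sum_mono)
          then show ?thesis by (intro simplex_basis_eq_0) auto
        qed
        then show ?thesis using span_on_zero by (simp cong: span_on_cong)
      qed
    qed
  qed
  then show ?thesis by blast
qed

subsection \<open>Charlier polynomials\<close>

text \<open>The Charlier generating function after the substitution z = \<mu> t.\<close>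

definition charlier_fps :: "real \<Rightarrow> nat \<Rightarrow> real fps" where
  "charlier_fps \<mu> x = fps_exp \<mu> * (1 - fps_X) ^ x"

text \<open>\<open>b\<^sub>n(x) = \<mu>\<^sup>n C\<^sub>n(x; \<mu>) / n!\<close>, a scaling in which the difference and derivative
  recurrences contain no division.\<close>

definition scaled_charlier :: "real \<Rightarrow> nat \<Rightarrow> nat \<Rightarrow> real" where
  "scaled_charlier \<mu> n x = fps_nth (charlier_fps \<mu> x) n"

lemma charlier_fps_Suc: "charlier_fps \<mu> (Suc x) = charlier_fps \<mu> x - charlier_fps \<mu> x * fps_X"
  by (simp add: charlier_fps_def algebra_simps)

lemma scaled_charlier_0_right [simp]: "scaled_charlier \<mu> n 0 = \<mu> ^ n / fact n"
  by (simp add: scaled_charlier_def charlier_fps_def)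

lemma scaled_charlier_0_left [simp]: "scaled_charlier \<mu> 0 x = 1"
  by (simp add: scaled_charlier_def charlier_fps_def fps_power_zeroth)

lemma scaled_charlier_Suc_right:
  "scaled_charlier \<mu> (Suc n) (Suc x) = scaled_charlier \<mu> (Suc n) x - scaled_charlier \<mu> n x"
  by (simp add: scaled_charlier_def charlier_fps_Suc)

text \<open>The product rule for e^(\<mu> t) (1 - t)^x. At \<open>x = 0\<close> the truncated
  exponent \<open>x - 1\<close> is harmless because of the factor \<open>of_nat x\<close>.\<close>

lemma fps_deriv_charlier_fps:
  "fps_deriv (charlier_fps \<mu> x) = fps_const \<mu> * charlier_fps \<mu> x - of_nat x * charlier_fps \<mu> (x - 1)"
proof (induction x)
  case (Suc x)
  have "of_nat x * charlier_fps \<mu> (x - 1) * (1 - fps_X) = of_nat x * charlier_fps \<mu> x"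
    by (cases x) (simp_all add: charlier_fps_def mult_ac)
  then have "fps_deriv (charlier_fps \<mu> x) * (1 - fps_X)
      = fps_const \<mu> * (charlier_fps \<mu> x * (1 - fps_X)) - of_nat x * charlier_fps \<mu> x"
    unfolding Suc.IH by (simp only: left_diff_distrib mult.assoc)
  then show ?case
    by (simp add: charlier_fps_Suc algebra_simps)
qed (simp add: charlier_fps_def)

lemma scaled_charlier_Suc_left:
  "real (Suc n) * scaled_charlier \<mu> (Suc n) x = \<mu> * scaled_charlier \<mu> n x - real x * scaled_charlier \<mu> n (x - 1)"
proof -
  have "fps_nth (fps_deriv (charlier_fps \<mu> x)) n = \<mu> * scaled_charlier \<mu> n x - real x * scaled_charlier \<mu> n (x - 1)"
    by (simp add: fps_deriv_charlier_fps scaled_charlier_def fps_of_nat[symmetric])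
  then show ?thesis by (simp add: scaled_charlier_def)
qed

text \<open>The degree-raising relation at n and at n - 1, together with x times the difference
  relation, involves two values at x - 1; these are eliminated.\<close>

lemma scaled_charlier_three_term:
  "real x * scaled_charlier \<mu> n x = - real (Suc n) * scaled_charlier \<mu> (Suc n) x
     + (\<mu> + real n) * scaled_charlier \<mu> n x + (if n = 0 then 0 else - \<mu>) * scaled_charlier \<mu> (n - 1) x"
proof (cases n)
  case 0
  then show ?thesis using scaled_charlier_Suc_left[of 0 \<mu> x] by simp
next
  case (Suc k)
  have 1: "real (Suc n) * scaled_charlier \<mu> (Suc n) x = \<mu> * scaled_charlier \<mu> n x - real x * scaled_charlier \<mu> n (x - 1)"
    by (rule scaled_charlier_Suc_left)
  have 2: "real n * scaled_charlier \<mu> n x = \<mu> * scaled_charlier \<mu> k x - real x * scaled_charlier \<mu> k (x - 1)"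
    unfolding Suc by (rule scaled_charlier_Suc_left)
  have 3: "real x * scaled_charlier \<mu> n x = real x * scaled_charlier \<mu> n (x - 1) - real x * scaled_charlier \<mu> k (x - 1)"
    using scaled_charlier_Suc_right[of \<mu> k "x - 1"] Suc by (cases x) (auto simp: right_diff_distrib)
  show ?thesis using 1 2 3 Suc by (simp add: algebra_simps)
qed

text \<open>A Poisson probability is at most 1.\<close>

lemma power_div_fact_le_exp:
  assumes "(0::real) < \<mu>"
  shows "\<mu> ^ n / fact n \<le> exp \<mu>"
  using pmf_le_1[of "poisson_pmf \<mu>" n] assms by (simp add: exp_minus field_simps)

text \<open>By the difference relation each unit of x at most doubles a bound that is uniform in n;
  the start is the value at x = 0.\<close>

lemma abs_scaled_charlier_le:
  assumes "0 < \<mu>"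
  shows "\<bar>scaled_charlier \<mu> n x\<bar> \<le> exp \<mu> * 2 ^ x"
proof (induction x arbitrary: n)
  case 0
  then show ?case using power_div_fact_le_exp[OF assms, of n] assms by simp
next
  case (Suc x)
  show ?case
  proof (cases n)
    case 0
    have "1 \<le> exp \<mu>" "(1::real) \<le> 2 ^ Suc x"
      using assms one_le_power[of "2::real" "Suc x"] by auto
    then have "1 * 1 \<le> exp \<mu> * 2 ^ Suc x" by (intro mult_mono) auto
    with 0 show ?thesis by simp
  next
    case (Suc k)
    have "\<bar>scaled_charlier \<mu> n (Suc x)\<bar> \<le> \<bar>scaled_charlier \<mu> n x\<bar> + \<bar>scaled_charlier \<mu> k x\<bar>"
      unfolding Suc scaled_charlier_Suc_right by (rule abs_triangle_ineq4)
    also have "\<dots> \<le> exp \<mu> * 2 ^ Suc x" using Suc.IH[of n] Suc.IH[of k] by simp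
    finally show ?thesis .
  qed
qed

section \<open>Orthogonality of the Charlier polynomials under the Poisson distribution\<close>

lemma integrable_measure_pmf_iff:
  "integrable (measure_pmf p) (f :: 'a \<Rightarrow> real) \<longleftrightarrow> integrable (count_space UNIV) (\<lambda>x. pmf p x * f x)"
  unfolding measure_pmf_eq_density by (subst integrable_density) auto

lemma expectation_eq_integral_count_space:
  "measure_pmf.expectation p (f :: 'a \<Rightarrow> real) = (\<integral>x. pmf p x * f x \<partial>count_space UNIV)"
  unfolding measure_pmf_eq_density by (subst integral_density) auto

text \<open>Comparison with the exponential series at 4 \<mu>. The rate 4^x is that of a product of
  two Charlier polynomials.\<close>

lemma integrable_poisson:
  assumes "0 < \<mu>" and f: "\<And>x. \<bar>f x\<bar> \<le> K * 4 ^ x"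
  shows "integrable (poisson_pmf \<mu>) (f :: nat \<Rightarrow> real)"
  unfolding integrable_measure_pmf_iff integrable_count_space_nat_iff
proof (rule summable_comparison_test)
  have "summable (\<lambda>x. inverse (fact x) * (4 * \<mu>) ^ x)" by (rule summable_exp)
  then show "summable (\<lambda>x. (K * exp (- \<mu>)) * (inverse (fact x) * (4 * \<mu>) ^ x))" by (rule summable_mult)
  have "norm (norm (pmf (poisson_pmf \<mu>) x * f x)) \<le> pmf (poisson_pmf \<mu>) x * (K * 4 ^ x)" for x
    using f[of x] by (simp add: abs_mult mult_left_mono)
  also have "pmf (poisson_pmf \<mu>) x * (K * 4 ^ x) = (K * exp (- \<mu>)) * (inverse (fact x) * (4 * \<mu>) ^ x)" for x
    using assms(1) by (simp add: field_simps)
  finally show "\<exists>N. \<forall>x\<ge>N. norm (norm (pmf (poisson_pmf \<mu>) x * f x))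
      \<le> (K * exp (- \<mu>)) * (inverse (fact x) * (4 * \<mu>) ^ x)" by blast
qed

text \<open>The Stein-Chen identity. Since x p(x) = \<mu> p(x - 1) and the term at x = 0 carries the
  factor 0, the two series differ by an index shift, and absolute convergence passes from one to the
  other.\<close>

lemma poisson_shift:
  fixes f :: "nat \<Rightarrow> real"
  assumes \<mu>: "0 < \<mu>" and f: "integrable (poisson_pmf \<mu>) (\<lambda>x. f (Suc x))"
  shows "integrable (poisson_pmf \<mu>) (\<lambda>x. real x * f x)"
    and "measure_pmf.expectation (poisson_pmf \<mu>) (\<lambda>x. real x * f x)
       = \<mu> * measure_pmf.expectation (poisson_pmf \<mu>) (\<lambda>x. f (Suc x))"
proof -
  let ?p = "pmf (poisson_pmf \<mu>)"
  have shift: "?p (Suc x) * (real (Suc x) * f (Suc x)) = \<mu> * (?p x * f (Suc x))" for x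
    using \<mu> by (simp add: field_simps del: of_nat_Suc)
  have f': "integrable (count_space UNIV) (\<lambda>x. ?p x * f (Suc x))"
    using f unfolding integrable_measure_pmf_iff .
  then have "summable (\<lambda>x. norm (?p x * f (Suc x)))"
    unfolding integrable_count_space_nat_iff .
  then have "summable (\<lambda>x. norm (?p (Suc x) * (real (Suc x) * f (Suc x))))"
    unfolding shift norm_mult[of \<mu>] by (rule summable_mult)
  then have "integrable (count_space UNIV) (\<lambda>x. ?p x * (real x * f x))"
    unfolding integrable_count_space_nat_iff by (subst (asm) summable_Suc_iff)
  then show "integrable (poisson_pmf \<mu>) (\<lambda>x. real x * f x)"
    and "measure_pmf.expectation (poisson_pmf \<mu>) (\<lambda>x. real x * f x)
       = \<mu> * measure_pmf.expectation (poisson_pmf \<mu>) (\<lambda>x. f (Suc x))"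
  proof -
    assume int: "integrable (count_space UNIV) (\<lambda>x. ?p x * (real x * f x))"
    then show "integrable (poisson_pmf \<mu>) (\<lambda>x. real x * f x)" unfolding integrable_measure_pmf_iff .
    have "(\<lambda>x. ?p x * f (Suc x)) sums measure_pmf.expectation (poisson_pmf \<mu>) (\<lambda>x. f (Suc x))"
      unfolding expectation_eq_integral_count_space by (rule sums_integral_count_space_nat[OF f'])
    then have "(\<lambda>x. \<mu> * (?p x * f (Suc x))) sums (\<mu> * measure_pmf.expectation (poisson_pmf \<mu>) (\<lambda>x. f (Suc x)))"
      by (rule sums_mult)
    then have "(\<lambda>x. ?p x * (real x * f x)) sums (\<mu> * measure_pmf.expectation (poisson_pmf \<mu>) (\<lambda>x. f (Suc x)))"
      unfolding shift[symmetric] by (subst (asm) sums_Suc_iff) simp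
    moreover have "(\<lambda>x. ?p x * (real x * f x)) sums measure_pmf.expectation (poisson_pmf \<mu>) (\<lambda>x. real x * f x)"
      unfolding expectation_eq_integral_count_space by (rule sums_integral_count_space_nat[OF int])
    ultimately show "measure_pmf.expectation (poisson_pmf \<mu>) (\<lambda>x. real x * f x)
       = \<mu> * measure_pmf.expectation (poisson_pmf \<mu>) (\<lambda>x. f (Suc x))"
      by (metis sums_unique2)
  qed
qed

lemma abs_scaled_charlier_mult_le:
  assumes "0 < \<mu>"
  shows "\<bar>scaled_charlier \<mu> n x * scaled_charlier \<mu> m y\<bar> \<le> exp \<mu> * exp \<mu> * (2 ^ x * 2 ^ y)"
  using mult_mono[OF abs_scaled_charlier_le[OF assms, of n x] abs_scaled_charlier_le[OF assms, of m y]]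
  by (simp add: abs_mult mult_ac)

lemma integrable_scaled_charlier_mult:
  assumes "0 < \<mu>"
  shows "integrable (poisson_pmf \<mu>) (\<lambda>x. scaled_charlier \<mu> n x * scaled_charlier \<mu> m x)"
proof (rule integrable_poisson[OF assms, of _ "exp \<mu> * exp \<mu>"])
  fix x
  have "(4::real) ^ x = 2 ^ x * 2 ^ x" by (simp flip: power_mult_distrib)
  then show "\<bar>scaled_charlier \<mu> n x * scaled_charlier \<mu> m x\<bar> \<le> exp \<mu> * exp \<mu> * 4 ^ x"
    using abs_scaled_charlier_mult_le[OF assms, of n x m x] by simp
qed

text \<open>The degree-raising relation in n produces values at x - 1; the shift moves them to x and
  turns the other factor into its value at x + 1. What remains of that factor is the difference
  b_m(x) - b_m(x + 1), which is b_{m-1}(x), so both degrees drop together.\<close>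

lemma expectation_scaled_charlier_Suc:
  assumes \<mu>: "0 < \<mu>"
  shows "real (Suc n) * measure_pmf.expectation (poisson_pmf \<mu>) (\<lambda>x. scaled_charlier \<mu> (Suc n) x * scaled_charlier \<mu> m x)
    = \<mu> * (if m = 0 then 0 else
        measure_pmf.expectation (poisson_pmf \<mu>) (\<lambda>x. scaled_charlier \<mu> n x * scaled_charlier \<mu> (m - 1) x))"
proof -
  let ?E = "measure_pmf.expectation (poisson_pmf \<mu>)" and ?b = "scaled_charlier \<mu>"
  have d: "?b m (Suc x) = ?b m x - (if m = 0 then 0 else ?b (m - 1) x)" for x
    by (cases m) (auto simp: scaled_charlier_Suc_right)
  have int1: "integrable (poisson_pmf \<mu>) (\<lambda>x. ?b n x * ?b m (Suc x))"
    unfolding d right_diff_distrib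
    using integrable_scaled_charlier_mult[OF \<mu>, of n m] integrable_scaled_charlier_mult[OF \<mu>, of n "m - 1"]
    by (cases "m = 0") simp_all
  \<comment> \<open>The function is written with \<open>x - 1\<close> so that its shift is exactly
    \<open>?b n x * ?b m (Suc x)\<close>.\<close>
  note shift = poisson_shift[OF \<mu>, of "\<lambda>x. ?b n (x - 1) * ?b m x", simplified, OF int1]
  have "real (Suc n) * ?E (\<lambda>x. ?b (Suc n) x * ?b m x) = ?E (\<lambda>x. real (Suc n) * ?b (Suc n) x * ?b m x)"
    by (simp only: integral_mult_right_zero mult.assoc)
  also have "\<dots> = ?E (\<lambda>x. \<mu> * (?b n x * ?b m x) - real x * (?b n (x - 1) * ?b m x))"
    by (simp only: scaled_charlier_Suc_left left_diff_distrib mult.assoc)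
  also have "\<dots> = ?E (\<lambda>x. \<mu> * (?b n x * ?b m x)) - ?E (\<lambda>x. real x * (?b n (x - 1) * ?b m x))"
    using integrable_scaled_charlier_mult[OF \<mu>] shift(1)
    by (intro Bochner_Integration.integral_diff) auto
  also have "\<dots> = \<mu> * (?E (\<lambda>x. ?b n x * ?b m x) - ?E (\<lambda>x. ?b n x * ?b m (Suc x)))"
    using shift(2) by (simp add: right_diff_distrib)
  also have "?E (\<lambda>x. ?b n x * ?b m x) - ?E (\<lambda>x. ?b n x * ?b m (Suc x))
     = ?E (\<lambda>x. ?b n x * ?b m x - ?b n x * ?b m (Suc x))"
    using integrable_scaled_charlier_mult[OF \<mu>] int1
    by (intro Bochner_Integration.integral_diff[symmetric]) auto
  also have "\<dots> = (if m = 0 then 0 else ?E (\<lambda>x. ?b n x * ?b (m - 1) x))"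
    unfolding d by (simp add: right_diff_distrib)
  finally show ?thesis .
qed

lemma expectation_scaled_charlier:
  assumes \<mu>: "0 < \<mu>"
  shows "measure_pmf.expectation (poisson_pmf \<mu>) (\<lambda>x. scaled_charlier \<mu> n x * scaled_charlier \<mu> m x)
     = (if m = n then \<mu> ^ n / fact n else 0)"
proof (induction n arbitrary: m)
  case 0
  show ?case
  proof (cases m)
    \<comment> \<open>With the two factors exchanged, the recursion applies to degrees
      \<open>Suc k\<close> and 0 and returns 0.\<close>
    case (Suc k)
    then show ?thesis
      using expectation_scaled_charlier_Suc[OF \<mu>, of k 0] by (simp add: mult.commute)
  qed simp
next
  case (Suc n)
  let ?E = "measure_pmf.expectation (poisson_pmf \<mu>) (\<lambda>x. scaled_charlier \<mu> (Suc n) x * scaled_charlier \<mu> m x)"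
  have "real (Suc n) * ?E = \<mu> * (if m = Suc n then \<mu> ^ n / fact n else 0)"
    unfolding expectation_scaled_charlier_Suc[OF \<mu>] using Suc.IH[of "m - 1"] by auto
  then have "?E = \<mu> * (if m = Suc n then \<mu> ^ n / fact n else 0) / real (Suc n)"
    by (metis nonzero_mult_div_cancel_left of_nat_0 of_nat_eq_iff nat.simps(3))
  then show ?case by simp
qed

definition normalized_charlier :: "real \<Rightarrow> nat \<Rightarrow> nat \<Rightarrow> real" where
  "normalized_charlier \<mu> n x = sqrt (fact n / \<mu> ^ n) * scaled_charlier \<mu> n x"

lemma normalized_charlier_mult:
  assumes "0 < \<mu>"
  shows "normalized_charlier \<mu> n x * normalized_charlier \<mu> n y
     = fact n / \<mu> ^ n * scaled_charlier \<mu> n x * scaled_charlier \<mu> n y"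
proof -
  have "sqrt (fact n / \<mu> ^ n) * sqrt (fact n / \<mu> ^ n) = fact n / \<mu> ^ n"
    using assms by (intro real_sqrt_mult_self[THEN trans]) simp
  then show ?thesis unfolding normalized_charlier_def by (metis mult.assoc mult.left_commute)
qed

lemma expectation_normalized_charlier:
  assumes "0 < \<mu>"
  shows "measure_pmf.expectation (poisson_pmf \<mu>) (\<lambda>x. normalized_charlier \<mu> n x * normalized_charlier \<mu> m x)
     = (if n = m then 1 else 0)"
proof -
  have "(\<lambda>x. normalized_charlier \<mu> n x * normalized_charlier \<mu> m x)
     = (\<lambda>x. sqrt (fact n / \<mu> ^ n) * sqrt (fact m / \<mu> ^ m) * (scaled_charlier \<mu> n x * scaled_charlier \<mu> m x))"
    by (simp add: normalized_charlier_def mult_ac fun_eq_iff)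
  then show ?thesis using assms by (simp add: expectation_scaled_charlier)
qed

lemma integrable_normalized_charlier_mult:
  assumes "0 < \<mu>"
  shows "integrable (poisson_pmf \<mu>) (\<lambda>x. normalized_charlier \<mu> n x * normalized_charlier \<mu> m x)"
proof -
  have "(\<lambda>x. normalized_charlier \<mu> n x * normalized_charlier \<mu> m x)
     = (\<lambda>x. sqrt (fact n / \<mu> ^ n) * sqrt (fact m / \<mu> ^ m) * (scaled_charlier \<mu> n x * scaled_charlier \<mu> m x))"
    by (simp add: normalized_charlier_def mult_ac fun_eq_iff)
  then show ?thesis using integrable_scaled_charlier_mult[OF assms] by simp
qed

lemma three_term_normalized_charlier:
  assumes "0 < \<mu>"
  shows "three_term (normalized_charlier \<mu>)"
  unfolding three_term_def
proof (intro conjI allI)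
  fix n
  define s where "s k = sqrt (fact k / \<mu> ^ k)" for k
  have s: "s k \<noteq> 0" for k using assms by (simp add: s_def)
  show "\<exists>\<alpha> \<beta> \<gamma>. \<alpha> \<noteq> 0 \<and> (n = 0 \<longrightarrow> \<gamma> = 0) \<and>
     (\<forall>x. real x * normalized_charlier \<mu> n x = \<alpha> * normalized_charlier \<mu> (Suc n) x
        + \<beta> * normalized_charlier \<mu> n x + \<gamma> * normalized_charlier \<mu> (n - 1) x)"
  proof (intro exI conjI allI impI)
    show "- real (Suc n) * (s n / s (Suc n)) \<noteq> 0" using s by simp
    fix x
    have "real x * normalized_charlier \<mu> n x = s n * (real x * scaled_charlier \<mu> n x)"
      by (simp add: normalized_charlier_def s_def)
    also have "\<dots> = - real (Suc n) * (s n / s (Suc n)) * (s (Suc n) * scaled_charlier \<mu> (Suc n) x)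
        + (\<mu> + real n) * (s n * scaled_charlier \<mu> n x)
        + (if n = 0 then 0 else - \<mu>) * (s n / s (n - 1)) * (s (n - 1) * scaled_charlier \<mu> (n - 1) x)"
      using s by (simp only: scaled_charlier_three_term distrib_left) simp
    finally show "real x * normalized_charlier \<mu> n x = - real (Suc n) * (s n / s (Suc n)) * normalized_charlier \<mu> (Suc n) x
        + (\<mu> + real n) * normalized_charlier \<mu> n x
        + (if n = 0 then 0 else - \<mu>) * (s n / s (n - 1)) * normalized_charlier \<mu> (n - 1) x"
      unfolding normalized_charlier_def s_def .
  qed simp
qed (simp add: normalized_charlier_def)

subsection \<open>The generating function of the kernels\<close>

definition mehler_weight :: "real \<Rightarrow> nat \<Rightarrow> nat \<Rightarrow> nat \<Rightarrow> real" where
  "mehler_weight \<mu> x y z = falling x z * falling y z / (\<mu> ^ z * fact z)"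

text \<open>Here \<open>fps_X\<close> stands for \<rho>. The exponent is a truncated difference, but
  it is the true one whenever z is at most x and y, and otherwise the weight is 0.\<close>

definition mehler_term :: "real \<Rightarrow> nat \<Rightarrow> nat \<Rightarrow> nat \<Rightarrow> real fps" where
  "mehler_term \<mu> x y z = fps_const (mehler_weight \<mu> x y z) * (fps_X ^ z * (1 - fps_X) ^ (x + y - 2 * z))"

lemma falling_Suc_Suc: "falling (Suc x) (Suc k) = real (Suc x) * falling x k"
  unfolding falling_def by (subst prod.lessThan_Suc_shift) simp

text \<open>A Pascal-type identity: splitting x + 1 = (x - z) + (z + 1) in the weight on the left
  gives the two weights on the right, while all three terms share one power of X and of 1 -
  X.\<close>

lemma mehler_term_Suc:
  assumes \<mu>: "0 < \<mu>" and z: "z \<le> y"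
  shows "mehler_term \<mu> (Suc x) (Suc y) (Suc z) = (1 - fps_X) * mehler_term \<mu> x (Suc y) (Suc z)
     + fps_const (real (Suc y) / \<mu>) * fps_X * mehler_term \<mu> x y z"
proof -
  let ?P = "fps_X ^ Suc z * (1 - fps_X) ^ (x + y - 2 * z) :: real fps"
  have 1: "mehler_term \<mu> (Suc x) (Suc y) (Suc z) = fps_const (mehler_weight \<mu> (Suc x) (Suc y) (Suc z)) * ?P"
    by (simp add: mehler_term_def)
  have 2: "(1 - fps_X) * mehler_term \<mu> x (Suc y) (Suc z) = fps_const (mehler_weight \<mu> x (Suc y) (Suc z)) * ?P"
  \<comment> \<open>For z at least x the truncated exponents no longer match, but then the falling
    factorial of x is 0 and both sides vanish.\<close>
  proof (cases "z < x")
    case True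
    then have "x + y - 2 * z = Suc (x + Suc y - 2 * Suc z)" using z by simp
    then show ?thesis by (simp add: mehler_term_def mult_ac)
  next
    case False
    then show ?thesis by (simp add: mehler_term_def mehler_weight_def falling_eq_0)
  qed
  have 3: "fps_const (real (Suc y) / \<mu>) * fps_X * mehler_term \<mu> x y z
     = fps_const (real (Suc y) / \<mu> * mehler_weight \<mu> x y z) * ?P"
    by (simp add: mehler_term_def mult_ac flip: fps_const_mult)
  have 4: "mehler_weight \<mu> (Suc x) (Suc y) (Suc z)
    = mehler_weight \<mu> x (Suc y) (Suc z) + real (Suc y) / \<mu> * mehler_weight \<mu> x y z"
  proof -
    have *: "(a + 1) * F * ((b + 1) * G) / (\<mu> * e * ((c + 1) * D))
        = (a - c) * F * ((b + 1) * G) / (\<mu> * e * ((c + 1) * D)) + (b + 1) / \<mu> * (F * G / (e * D))"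
      if "c + 1 \<noteq> 0" "D \<noteq> 0" "e \<noteq> 0" for a b c D e F G :: real
      using that \<mu> by (simp add: divide_simps) (simp add: algebra_simps)
    show ?thesis
      using *[of "real z" "fact z" "\<mu> ^ z" "real x" "falling x z" "real y" "falling y z"] \<mu>
      unfolding mehler_weight_def falling_Suc_Suc falling_Suc[of x]
      by (simp add: add.commute)
  qed
  show ?thesis unfolding 1 2 3 4 by (simp add: distrib_right flip: fps_const_add)
qed

lemma mehler_formula:
  assumes \<mu>: "0 < \<mu>"
  shows "Abs_fps (\<lambda>n. normalized_charlier \<mu> n x * normalized_charlier \<mu> n y)
     = fps_exp \<mu> * (\<Sum>z\<le>y. mehler_term \<mu> x y z)"
proof (induction x arbitrary: y)
  case 0
  \<comment> \<open>The value \<mu>^n / n! at x = 0 cancels the normalisation n! / \<mu>^n, which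
    leaves the generating function in y.\<close>
  have "Abs_fps (\<lambda>n. normalized_charlier \<mu> n 0 * normalized_charlier \<mu> n y) = charlier_fps \<mu> y"
    using \<mu> by (simp add: fps_eq_iff normalized_charlier_mult scaled_charlier_def[of _ _ y])
  moreover have "(\<Sum>z\<le>y. mehler_term \<mu> 0 y z) = (\<Sum>z\<in>{0}. mehler_term \<mu> 0 y z)"
    by (rule sum.mono_neutral_right) (auto simp: mehler_term_def mehler_weight_def falling_eq_0)
  ultimately show ?case
    by (simp add: charlier_fps_def mehler_term_def mehler_weight_def falling_def)
next
  case (Suc x)
  let ?H = "\<lambda>x y. Abs_fps (\<lambda>n. normalized_charlier \<mu> n x * normalized_charlier \<mu> n y)"
  let ?T = "\<lambda>x y. \<Sum>z\<le>y. mehler_term \<mu> x y z"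
  let ?b = "scaled_charlier \<mu>"
  \<comment> \<open>The difference relation in x lowers the degree of the first factor; the
    remaining b_{k+1}(y) is lowered by the degree-raising relation, which brings in y - 1. At
    \<open>y = 0\<close> the coefficient \<open>real y\<close> removes the truncated term.\<close>
  have H: "?H (Suc x) y = (1 - fps_X) * ?H x y + fps_const (real y / \<mu>) * fps_X * ?H x (y - 1)"
  proof (rule fps_ext)
    fix n
    show "fps_nth (?H (Suc x) y) n
      = fps_nth ((1 - fps_X) * ?H x y + fps_const (real y / \<mu>) * fps_X * ?H x (y - 1)) n"
    proof (cases n)
      case 0
      then show ?thesis using \<mu> by (simp add: normalized_charlier_mult mult.assoc left_diff_distrib)
    next
      case (Suc k)
      have "(fact (Suc k) / \<mu> ^ Suc k) * ?b k x * ?b (Suc k) y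
          = fact k / \<mu> ^ k * ?b k x * ((real (Suc k) * ?b (Suc k) y) / \<mu>)"
        by (simp add: mult_ac)
      also have "(real (Suc k) * ?b (Suc k) y) / \<mu> = ?b k y - real y / \<mu> * ?b k (y - 1)"
        using \<mu> unfolding scaled_charlier_Suc_left by (simp add: diff_divide_distrib)
      finally have 1: "(fact (Suc k) / \<mu> ^ Suc k) * ?b k x * ?b (Suc k) y
          = fact k / \<mu> ^ k * ?b k x * ?b k y - real y / \<mu> * (fact k / \<mu> ^ k * ?b k x * ?b k (y - 1))"
        by (simp only: right_diff_distrib mult_ac)
      have "fps_nth (?H (Suc x) y) n = (fact (Suc k) / \<mu> ^ Suc k) * ?b (Suc k) x * ?b (Suc k) y
          - (fact (Suc k) / \<mu> ^ Suc k) * ?b k x * ?b (Suc k) y"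
        by (simp only: Suc fps_nth_Abs_fps normalized_charlier_mult[OF \<mu>] scaled_charlier_Suc_right
            left_diff_distrib right_diff_distrib)
      also have "\<dots> = fps_nth ((1 - fps_X) * ?H x y + fps_const (real y / \<mu>) * fps_X * ?H x (y - 1)) n"
        unfolding 1
        by (simp add: Suc normalized_charlier_mult[OF \<mu>] mult.assoc left_diff_distrib del: fact_Suc power_Suc)
      finally show ?thesis .
    qed
  qed
  have T: "?T (Suc x) y = (1 - fps_X) * ?T x y + fps_const (real y / \<mu>) * fps_X * ?T x (y - 1)"
  proof (cases y)
    case 0
    then show ?thesis by (simp add: mehler_term_def mehler_weight_def falling_def)
  next
    case (Suc w)
    have "?T (Suc x) y = mehler_term \<mu> (Suc x) y 0 + (\<Sum>z\<le>w. mehler_term \<mu> (Suc x) y (Suc z))"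
      unfolding Suc by (rule sum.atMost_Suc_shift)
    also have "mehler_term \<mu> (Suc x) y 0 = (1 - fps_X) * mehler_term \<mu> x y 0"
      by (simp add: mehler_term_def mehler_weight_def falling_def)
    also have "(\<Sum>z\<le>w. mehler_term \<mu> (Suc x) y (Suc z)) = (\<Sum>z\<le>w. (1 - fps_X) * mehler_term \<mu> x y (Suc z)
        + fps_const (real y / \<mu>) * fps_X * mehler_term \<mu> x w z)"
      unfolding Suc by (intro sum.cong mehler_term_Suc[OF \<mu>]) auto
    also have "\<dots> = (1 - fps_X) * (\<Sum>z\<le>w. mehler_term \<mu> x y (Suc z))
        + fps_const (real y / \<mu>) * fps_X * (\<Sum>z\<le>w. mehler_term \<mu> x w z)"
      by (simp add: sum.distrib sum_distrib_left)
    also have "(1 - fps_X) * mehler_term \<mu> x y 0 + \<dots> = (1 - fps_X) * (mehler_term \<mu> x y 0 + (\<Sum>z\<le>w. mehler_term \<mu> x y (Suc z)))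
        + fps_const (real y / \<mu>) * fps_X * (\<Sum>z\<le>w. mehler_term \<mu> x w z)"
      by (simp only: distrib_left add.assoc)
    also have "mehler_term \<mu> x y 0 + (\<Sum>z\<le>w. mehler_term \<mu> x y (Suc z)) = ?T x y"
      unfolding Suc by (rule sum.atMost_Suc_shift[symmetric])
    finally show ?thesis using Suc by simp
  qed
  show ?case unfolding H T Suc.IH by (simp only: distrib_left mult_ac)
qed

lemma fps_nth_prod:
  fixes a :: "'i \<Rightarrow> 'a::comm_ring_1 fps"
  assumes "finite S"
  shows "fps_nth (\<Prod>i\<in>S. a i) n
     = (\<Sum>m | (\<forall>i. i \<notin> S \<longrightarrow> m i = 0) \<and> sum m S = n. \<Prod>i\<in>S. fps_nth (a i) (m i))"
  using assms
proof (induction S arbitrary: n rule: finite_induct)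
  case empty
  have "{x :: 'i \<Rightarrow> nat. (\<forall>i. x i = 0) \<and> 0 = n} = (if n = 0 then {\<lambda>_. 0} else {})" by auto
  then show ?case by simp
next
  case (insert j S)
  let ?X = "\<lambda>S n. {m :: 'i \<Rightarrow> nat. (\<forall>i. i \<notin> S \<longrightarrow> m i = 0) \<and> sum m S = n}"
  have upd_sum: "(\<Sum>i\<in>S. if i = j then k else m i) = sum m S" for m :: "'i \<Rightarrow> nat" and k
    by (rule sum.cong) (use insert.hyps in auto)
  have upd_prod: "(\<Prod>i\<in>S. fps_nth (a i) (if i = j then k else m i)) = (\<Prod>i\<in>S. fps_nth (a i) (m i))" for m k
    by (rule prod.cong) (use insert.hyps in auto)
  have "fps_nth (\<Prod>i\<in>insert j S. a i) n = (\<Sum>k\<le>n. fps_nth (a j) k * (\<Sum>m\<in>?X S (n - k). \<Prod>i\<in>S. fps_nth (a i) (m i)))"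
    using insert by (simp add: fps_mult_nth atLeast0AtMost)
  also have "\<dots> = (\<Sum>(k, m)\<in>Sigma {..n} (\<lambda>k. ?X S (n - k)). fps_nth (a j) k * (\<Prod>i\<in>S. fps_nth (a i) (m i)))"
    unfolding sum_distrib_left
    by (rule sum.Sigma) (use insert.hyps in \<open>auto intro: finite_compositions\<close>)
  also have "\<dots> = (\<Sum>m\<in>?X (insert j S) n. \<Prod>i\<in>insert j S. fps_nth (a i) (m i))"
  proof (rule sum.reindex_bij_witness[symmetric,
      where i = "\<lambda>(k, m). m(j := k)" and j = "\<lambda>m. (m j, m(j := 0))"], goal_cases)
    case (2 m) then show ?case using insert.hyps by (auto simp: fun_upd_def upd_sum)
  next
    case (3 y) then show ?case using insert.hyps by (auto simp: fun_eq_iff)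
  next
    case (4 y) then show ?case using insert.hyps by (auto simp: fun_upd_def upd_sum)
  next
    case (5 m) then show ?case using insert.hyps by (auto simp: fun_upd_def upd_prod)
  qed auto
  finally show ?case .
qed

lemma fps_exp_sum:
  "finite S \<Longrightarrow> fps_exp (\<Sum>i\<in>S. f i) = (\<Prod>i\<in>S. fps_exp (f i :: 'a::field_char_0))"
  by (induction S rule: finite_induct) (auto simp: fps_exp_add_mult)

text \<open>The closed form of the Poisson kernel as a formal power series in \<rho>: its
  coefficients give the kernels one by one, its evaluation gives the summed identity.\<close>

definition mehler_fps :: "('d::finite \<Rightarrow> real) \<Rightarrow> ('d \<Rightarrow> nat) \<Rightarrow> ('d \<Rightarrow> nat) \<Rightarrow> real fps" where
  "mehler_fps \<mu> x y = fps_exp (total \<mu>) * (\<Sum>z | z \<le> x \<and> z \<le> y.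
      fps_const (\<Prod>i\<in>UNIV. mehler_weight (\<mu> i) (x i) (y i) (z i)) *
        (fps_X ^ total z * (1 - fps_X) ^ (total x + total y - 2 * total z)))"

lemma fps_const_prod: "fps_const (\<Prod>i\<in>S. f i) = (\<Prod>i\<in>S. fps_const (f i :: 'a::comm_ring_1))"
  by (induction S rule: infinite_finite_induct) (simp_all flip: fps_const_mult)

lemma finite_vectors_le: "finite {z :: 'd::finite \<Rightarrow> nat. z \<le> x \<and> z \<le> y}"
  by (rule finite_subset[OF _ finite_total_le[of "total x"]]) (auto simp: le_fun_def intro: sum_mono)

lemma mehler_formula_product:
  fixes \<mu> :: "'d::finite \<Rightarrow> real"
  assumes \<mu>: "\<And>i. 0 < \<mu> i"
  shows "(\<Sum>m | total m = n. prod_basis id (\<lambda>i. normalized_charlier (\<mu> i)) m x * prod_basis id (\<lambda>i. normalized_charlier (\<mu> i)) m y)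
     = fps_nth (mehler_fps \<mu> x y) n"
proof -
  let ?q = "\<lambda>i. normalized_charlier (\<mu> i)"
  let ?a = "\<lambda>i. Abs_fps (\<lambda>n. ?q i n (x i) * ?q i n (y i))"
  have "(\<Sum>m | total m = n. prod_basis id ?q m x * prod_basis id ?q m y) = fps_nth (\<Prod>i\<in>UNIV. ?a i) n"
    by (simp add: fps_nth_prod prod_basis_def prod.distrib)
  also have "(\<Prod>i\<in>UNIV. ?a i) = (\<Prod>i\<in>UNIV. fps_exp (\<mu> i) * (\<Sum>z\<le>y i. mehler_term (\<mu> i) (x i) (y i) z))"
    by (simp add: mehler_formula[OF \<mu>])
  also have "\<dots> = fps_exp (total \<mu>) * (\<Sum>z\<in>PiE UNIV (\<lambda>i. {..y i}). \<Prod>i\<in>UNIV. mehler_term (\<mu> i) (x i) (y i) (z i))"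
    by (simp add: prod.distrib fps_exp_sum prod_sum_PiE)
  \<comment> \<open>Distributing the product leaves only the bound by y; any z exceeding x in some
    coordinate contributes a zero factor.\<close>
  also have "(\<Sum>z\<in>PiE UNIV (\<lambda>i. {..y i}). \<Prod>i\<in>UNIV. mehler_term (\<mu> i) (x i) (y i) (z i))
      = (\<Sum>z | z \<le> x \<and> z \<le> y. \<Prod>i\<in>UNIV. mehler_term (\<mu> i) (x i) (y i) (z i))"
  proof (rule sum.mono_neutral_right)
    show "finite (PiE UNIV (\<lambda>i. {..y i}))" by (rule finite_PiE) auto
    show "{z. z \<le> x \<and> z \<le> y} \<subseteq> PiE UNIV (\<lambda>i. {..y i})" by (auto simp: le_fun_def)
    show "\<forall>z\<in>PiE UNIV (\<lambda>i. {..y i}) - {z. z \<le> x \<and> z \<le> y}. (\<Prod>i\<in>UNIV. mehler_term (\<mu> i) (x i) (y i) (z i)) = 0"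
    proof
      fix z assume "z \<in> PiE UNIV (\<lambda>i. {..y i}) - {z. z \<le> x \<and> z \<le> y}"
      then have "\<not> z \<le> x" by (auto simp: le_fun_def PiE_def)
      then obtain i where "x i < z i" by (auto simp: le_fun_def not_le)
      then show "(\<Prod>i\<in>UNIV. mehler_term (\<mu> i) (x i) (y i) (z i)) = 0"
        by (intro prod_zero) (auto simp: mehler_term_def mehler_weight_def falling_eq_0 intro!: exI[of _ i])
    qed
  qed
  also have "\<dots> = (\<Sum>z | z \<le> x \<and> z \<le> y. fps_const (\<Prod>i\<in>UNIV. mehler_weight (\<mu> i) (x i) (y i) (z i)) *
        (fps_X ^ total z * (1 - fps_X) ^ (total x + total y - 2 * total z)))"
  proof (rule sum.cong)
    fix z assume "z \<in> {z. z \<le> x \<and> z \<le> y}"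
    \<comment> \<open>This makes the natural-number subtraction additive over the
      coordinates.\<close>
    then have z: "2 * z i \<le> x i + y i" for i
      by (auto simp: le_fun_def mult_2 intro: add_mono)
    have "(\<Sum>i\<in>UNIV. x i + y i - 2 * z i) = total x + total y - 2 * total z"
      using z by (simp add: sum_subtractf_nat sum.distrib sum_distrib_left)
    then show "(\<Prod>i\<in>UNIV. mehler_term (\<mu> i) (x i) (y i) (z i)) = fps_const (\<Prod>i\<in>UNIV. mehler_weight (\<mu> i) (x i) (y i) (z i)) *
        (fps_X ^ total z * (1 - fps_X) ^ (total x + total y - 2 * total z))"
      by (simp add: mehler_term_def prod.distrib fps_const_prod power_sum[symmetric])
  qed simp
  finally show ?thesis unfolding mehler_fps_def .
qed

section \<open>Charlier products as an orthonormal set for the product Poisson distribution\<close>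

lemma expectation_prod_Pi_pmf_real:
  fixes f :: "'a \<Rightarrow> 'b \<Rightarrow> real" and p :: "'a \<Rightarrow> 'b pmf"
  assumes A: "finite A" and int: "\<And>x. x \<in> A \<Longrightarrow> integrable (p x) (f x)"
  shows "measure_pmf.expectation (Pi_pmf A dflt p) (\<lambda>h. \<Prod>x\<in>A. f x (h x))
     = (\<Prod>x\<in>A. measure_pmf.expectation (p x) (f x))"
proof -
  have marg: "map_pmf (\<lambda>h. h x) (Pi_pmf A dflt p) = p x" if "x \<in> A" for x
    using that A by (simp add: Pi_pmf_component)
  have "prob_space.indep_vars (Pi_pmf A dflt p) (\<lambda>_. borel) (\<lambda>x h. f x (h x)) A"
    by (rule prob_space.indep_vars_compose2[OF measure_pmf.prob_space_axioms indep_vars_Pi_pmf[OF A]]) simp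
  moreover have "integrable (Pi_pmf A dflt p) (\<lambda>h. f x (h x))" if "x \<in> A" for x
    using int[OF that] integrable_map_pmf_eq[of "\<lambda>h. h x" "Pi_pmf A dflt p" "f x"] marg[OF that] by simp
  ultimately have "measure_pmf.expectation (Pi_pmf A dflt p) (\<lambda>h. \<Prod>x\<in>A. f x (h x))
      = (\<Prod>x\<in>A. measure_pmf.expectation (Pi_pmf A dflt p) (\<lambda>h. f x (h x)))"
    by (intro prob_space.indep_vars_lebesgue_integral[OF measure_pmf.prob_space_axioms A])
  also have "\<dots> = (\<Prod>x\<in>A. measure_pmf.expectation (p x) (f x))"
  proof (rule prod.cong)
    fix x assume "x \<in> A"
    then show "measure_pmf.expectation (Pi_pmf A dflt p) (\<lambda>h. f x (h x)) = measure_pmf.expectation (p x) (f x)"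
      using integral_map_pmf[of "\<lambda>h. h x" "Pi_pmf A dflt p" "f x"] marg by simp
  qed simp
  finally show ?thesis .
qed

lemma set_pmf_product_poisson:
  assumes "\<And>i. 0 < \<mu> i"
  shows "set_pmf (product_poisson \<mu>) = UNIV"
proof -
  have "pmf (product_poisson \<mu>) x > 0" for x
    unfolding pmf_product_poisson[OF assms] using assms by (intro prod_pos) simp
  then show ?thesis by (auto simp: set_pmf_iff dual_order.strict_implies_not_eq)
qed

abbreviation charlier_basis ::
  "('d \<Rightarrow> 'a) \<Rightarrow> ('d::finite \<Rightarrow> real) \<Rightarrow> ('d \<Rightarrow> nat) \<Rightarrow> ('a \<Rightarrow> nat) \<Rightarrow> real" where
  "charlier_basis h \<mu> \<equiv> prod_basis h (\<lambda>i. normalized_charlier (\<mu> i))"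

lemma expectation_charlier_basis:
  assumes "\<And>i. 0 < \<mu> i"
  shows "measure_pmf.expectation (product_poisson \<mu>) (\<lambda>x. charlier_basis id \<mu> l x * charlier_basis id \<mu> m x)
     = (if l = m then 1 else 0)"
proof -
  have "measure_pmf.expectation (product_poisson \<mu>) (\<lambda>x. charlier_basis id \<mu> l x * charlier_basis id \<mu> m x)
     = (\<Prod>i\<in>UNIV. measure_pmf.expectation (poisson_pmf (\<mu> i))
          (\<lambda>x. normalized_charlier (\<mu> i) (l i) x * normalized_charlier (\<mu> i) (m i) x))"
    unfolding prod_basis_def prod.distrib[symmetric] id_apply product_poisson_def
    by (rule expectation_prod_Pi_pmf_real) (auto intro: integrable_normalized_charlier_mult assms)
  also have "\<dots> = (\<Prod>i\<in>UNIV. if l i = m i then 1 else 0)"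
    using assms by (simp add: expectation_normalized_charlier)
  also have "\<dots> = (if l = m then 1 else 0)"
    by (auto simp: fun_eq_iff)
  finally show ?thesis .
qed

lemma complete_orthonormal_charlier_basis:
  assumes \<mu>: "\<And>i. 0 < \<mu> i"
  shows "complete_orthonormal (product_poisson \<mu>) UNIV (charlier_basis id \<mu>)"
proof (rule complete_orthonormalI)
  show "orthonormal_on (product_poisson \<mu>) UNIV (charlier_basis id \<mu>)"
    unfolding orthonormal_on_def using expectation_charlier_basis[of \<mu>, OF \<mu>] by blast
  show "poly_le_on (set_pmf (product_poisson \<mu>)) (total m) (charlier_basis id \<mu> m)" for m
    by (rule poly_le_on_prod_basis) (rule three_term_normalized_charlier[OF \<mu>])
  show "span_on (set_pmf (product_poisson \<mu>)) (charlier_basis id \<mu>) {m. m \<in> UNIV \<and> total m \<le> k} f"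
    if "poly_le_on (set_pmf (product_poisson \<mu>)) k f" for k f
    using poly_le_on_imp_span_on_prod_basis[OF three_term_normalized_charlier[OF \<mu>] that] by simp
qed

lemma poisson_kernel_poly_eq_sum:
  assumes \<mu>: "\<And>i. 0 < \<mu> i"
  shows "poisson_kernel_poly n x y \<mu> = (\<Sum>m | total m = n. charlier_basis id \<mu> m x * charlier_basis id \<mu> m y)"
  unfolding poisson_kernel_poly_def
  by (subst reproducing_kernel_eq[OF complete_orthonormal_charlier_basis[OF \<mu>]])
     (simp_all add: set_pmf_product_poisson[OF \<mu>])

lemma poisson_kernel_poly_eq_nth:
  "(\<And>i. 0 < \<mu> i) \<Longrightarrow> poisson_kernel_poly n x y \<mu> = fps_nth (mehler_fps \<mu> x y) n"
  by (simp add: poisson_kernel_poly_eq_sum mehler_formula_product)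

lemma poisson_kernel_poly_0:
  assumes \<mu>: "\<And>i. 0 < \<mu> i"
  shows "poisson_kernel_poly 0 x y \<mu> = 1"
proof -
  have "{m :: 'a \<Rightarrow> nat. total m = 0} = {\<lambda>_. 0}" by auto
  then show ?thesis
    unfolding poisson_kernel_poly_eq_sum[OF \<mu>]
    by (simp add: prod_basis_def normalized_charlier_def)
qed

lemma total_pos: "(\<And>i. 0 < \<mu> i) \<Longrightarrow> 0 < total (\<mu> :: 'd::finite \<Rightarrow> real)"
  by (rule sum_pos) auto

section \<open>The kernel in terms of Charlier polynomials\<close>

text \<open>Substituting X / a into e^(a X) (1 - X)^x gives the defining series of
  \<open>charlier\<close> and divides the n-th coefficient by a^n.\<close>

lemma charlier_eq_scaled:
  assumes "a \<noteq> 0"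
  shows "a ^ n / fact n * charlier n x a = scaled_charlier a n x"
proof -
  have "(1 - fps_X :: real fps) oo (fps_const (1 / a) * fps_X) = 1 - fps_const (1 / a) * fps_X"
    by (simp add: fps_compose_sub_distrib)
  then have "fps_exp 1 * (1 - fps_const (1 / a) * fps_X) ^ x = charlier_fps a x oo (fps_const (1 / a) * fps_X)"
    using assms unfolding charlier_fps_def
    by (simp add: fps_compose_mult_distrib fps_compose_power[symmetric])
  then show ?thesis
    using assms by (simp add: charlier_def scaled_charlier_def power_divide)
qed

lemma poisson_kernel_poly_charlier:
  fixes \<mu> :: "'d::finite \<Rightarrow> real"
  assumes \<mu>: "\<And>i. 0 < \<mu> i"
  shows "poisson_kernel_poly n x y \<mu> =
          (\<Sum>z | z \<le> x \<and> z \<le> y \<and> total z \<le> n.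
             total \<mu> ^ (n - total z) / fact (n - total z) *
             charlier (n - total z) (total x + total y - 2 * total z) (total \<mu>) *
             (\<Prod>i\<in>UNIV. falling (x i) (z i) * falling (y i) (z i) / (\<mu> i ^ z i * fact (z i))))"
proof -
  let ?w = "\<lambda>z. \<Prod>i\<in>UNIV. mehler_weight (\<mu> i) (x i) (y i) (z i)"
  let ?e = "\<lambda>z. total x + total y - 2 * total z"
  have "poisson_kernel_poly n x y \<mu> = (\<Sum>z | z \<le> x \<and> z \<le> y. fps_nth (fps_exp (total \<mu>) * (fps_const (?w z) *
        (fps_X ^ total z * (1 - fps_X) ^ ?e z))) n)"
    unfolding poisson_kernel_poly_eq_nth[OF \<mu>] mehler_fps_def
    by (simp only: sum_distrib_left fps_sum_nth)
  also have "\<dots> = (\<Sum>z | z \<le> x \<and> z \<le> y. fps_nth (fps_const (?w z) * (fps_X ^ total z * charlier_fps (total \<mu>) (?e z))) n)"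
    by (simp only: charlier_fps_def mult_ac)
  \<comment> \<open>The factor X^|z| shifts the index to n - |z| and removes the terms with |z| >
    n.\<close>
  also have "\<dots> = (\<Sum>z | z \<le> x \<and> z \<le> y. if total z \<le> n then ?w z * scaled_charlier (total \<mu>) (n - total z) (?e z) else 0)"
    by (intro sum.cong) (auto simp: fps_X_power_mult_nth scaled_charlier_def)
  also have "\<dots> = (\<Sum>z\<in>{z \<in> {z. z \<le> x \<and> z \<le> y}. total z \<le> n}. ?w z * scaled_charlier (total \<mu>) (n - total z) (?e z))"
    by (rule sum.inter_filter[symmetric]) (rule finite_vectors_le)
  also have "{z \<in> {z. z \<le> x \<and> z \<le> y}. total z \<le> n} = {z. z \<le> x \<and> z \<le> y \<and> total z \<le> n}" by auto
  finally show ?thesis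
    unfolding charlier_eq_scaled[OF total_pos[of \<mu>, OF \<mu>, THEN less_imp_neq, symmetric]] mehler_weight_def
    by (simp only: mult.commute)
qed

section \<open>Evaluation of the generating function\<close>

lemma fps_conv_radius_mult_infinity:
  "fps_conv_radius f = \<infinity> \<Longrightarrow> fps_conv_radius g = \<infinity> \<Longrightarrow> fps_conv_radius (f * g) = \<infinity>"
  using fps_conv_radius_mult[of f g] by simp

lemma fps_conv_radius_sum_infinity:
  "(\<And>i. i \<in> I \<Longrightarrow> fps_conv_radius (f i) = \<infinity>) \<Longrightarrow> fps_conv_radius (\<Sum>i\<in>I. f i) = \<infinity>"
proof (induction I rule: infinite_finite_induct)
  case (insert i I)
  then show ?case using fps_conv_radius_add[of "f i" "\<Sum>i\<in>I. f i"] by simp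
qed simp_all

lemma eval_fps_sum:
  assumes "\<And>i. i \<in> I \<Longrightarrow> fps_conv_radius (f i) = \<infinity>"
  shows "eval_fps (\<Sum>i\<in>I. f i) z = (\<Sum>i\<in>I. eval_fps (f i) z)"
  using assms
proof (induction I rule: infinite_finite_induct)
  case (insert i I)
  then show ?case
    using fps_conv_radius_sum_infinity[of I f] by (simp add: eval_fps_add)
qed simp_all

definition poisson_kernel_sum :: "('d::finite \<Rightarrow> real) \<Rightarrow> ('d \<Rightarrow> nat) \<Rightarrow> ('d \<Rightarrow> nat) \<Rightarrow> real \<Rightarrow> real" where
  "poisson_kernel_sum \<mu> x y \<rho> = exp (total \<mu> * \<rho>) *
          (\<Sum>z | z \<le> x \<and> z \<le> y.
             \<rho> ^ total z * (1 - \<rho>) ^ (total x + total y - 2 * total z) *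
             (\<Prod>i\<in>UNIV. falling (x i) (z i) * falling (y i) (z i) / (\<mu> i ^ z i * fact (z i))))"

text \<open>The series is an exponential times a polynomial, hence entire; this is why the kernel
  identity holds for every real \<rho>.\<close>

lemma eval_fps_mehler_fps:
  shows "fps_conv_radius (mehler_fps \<mu> x y) = \<infinity>"
    and "eval_fps (mehler_fps \<mu> x y) \<rho> = poisson_kernel_sum \<mu> x y \<rho>"
proof -
  let ?w = "\<lambda>z. \<Prod>i\<in>UNIV. mehler_weight (\<mu> i) (x i) (y i) (z i)"
  let ?e = "\<lambda>z. total x + total y - 2 * total z"
  let ?p = "\<lambda>z. fps_const (?w z) * (fps_X ^ total z * (1 - fps_X) ^ ?e z)"
  have 1: "fps_conv_radius (1 - fps_X :: real fps) = \<infinity>"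
    using fps_conv_radius_diff[of 1 "fps_X :: real fps"] by simp
  have 2: "fps_conv_radius ((1 - fps_X :: real fps) ^ k) = \<infinity>" for k
    using fps_conv_radius_power[of "1 - fps_X :: real fps" k] 1 by simp
  have 3: "fps_conv_radius (fps_X ^ j * (1 - fps_X :: real fps) ^ k) = \<infinity>" for j k
    by (intro fps_conv_radius_mult_infinity 2) simp
  have 4: "fps_conv_radius (?p z) = \<infinity>" for z
    by (intro fps_conv_radius_mult_infinity 3) simp
  have 5: "fps_conv_radius (\<Sum>z | z \<le> x \<and> z \<le> y. ?p z) = \<infinity>"
    by (intro fps_conv_radius_sum_infinity 4)
  show "fps_conv_radius (mehler_fps \<mu> x y) = \<infinity>"
    unfolding mehler_fps_def by (intro fps_conv_radius_mult_infinity 5) simp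
  have "eval_fps (?p z) \<rho> = ?w z * (\<rho> ^ total z * (1 - \<rho>) ^ ?e z)" for z
    using 1 2 3 by (simp add: eval_fps_mult eval_fps_power eval_fps_diff)
  then have "eval_fps (?p z) \<rho> = \<rho> ^ total z * (1 - \<rho>) ^ ?e z * ?w z" for z
    by (simp only: mult.commute)
  then show "eval_fps (mehler_fps \<mu> x y) \<rho> = poisson_kernel_sum \<mu> x y \<rho>"
    unfolding mehler_fps_def poisson_kernel_sum_def
    using 4 5 by (simp add: eval_fps_mult eval_fps_sum mehler_weight_def)
qed

lemma poisson_kernel_series:
  assumes \<mu>: "\<And>i. 0 < \<mu> i"
  shows "(\<lambda>n. \<rho> ^ Suc n * poisson_kernel_poly (Suc n) x y \<mu>) sums (poisson_kernel_sum \<mu> x y \<rho> - 1)"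
proof -
  have "(\<lambda>n. fps_nth (mehler_fps \<mu> x y) n * \<rho> ^ n) sums eval_fps (mehler_fps \<mu> x y) \<rho>"
    by (rule sums_eval_fps) (simp add: eval_fps_mehler_fps(1))
  then have "(\<lambda>n. \<rho> ^ n * poisson_kernel_poly n x y \<mu>) sums poisson_kernel_sum \<mu> x y \<rho>"
    by (simp add: eval_fps_mehler_fps(2) poisson_kernel_poly_eq_nth[OF \<mu>] mult.commute)
  then show ?thesis
    by (subst sums_Suc_iff) (simp add: poisson_kernel_poly_0[OF \<mu>])
qed

lemma poisson_kernel_sum_nonneg:
  assumes \<mu>: "\<And>i. 0 < \<mu> i" and "0 \<le> \<rho>" "\<rho> \<le> 1"
  shows "0 \<le> poisson_kernel_sum \<mu> x y \<rho>"
  unfolding poisson_kernel_sum_def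
proof (intro mult_nonneg_nonneg sum_nonneg prod_nonneg)
  fix z i assume "z \<in> {z. z \<le> x \<and> z \<le> y}"
  then have "z i \<le> x i" "z i \<le> y i" by (auto simp: le_fun_def)
  then show "0 \<le> falling (x i) (z i) * falling (y i) (z i) / (\<mu> i ^ z i * fact (z i))"
    using falling_pos[of "z i" "x i"] falling_pos[of "z i" "y i"] \<mu>[of i] by simp
qed (use assms in auto)

subsection \<open>The Poisson limit of the multinomial distribution\<close>

text \<open>Both bounds of the squeeze come from 1 + t \<le> e^t: t = -s bounds the power from
  above, and t = s / (1 - s) bounds it from below.\<close>

lemma power_one_minus_tendsto_exp:
  fixes s :: "nat \<Rightarrow> real" and k :: "nat \<Rightarrow> nat"
  assumes s: "s \<longlonglongrightarrow> 0" and ks: "(\<lambda>N. real (k N) * s N) \<longlonglongrightarrow> a"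
  shows "(\<lambda>N. (1 - s N) ^ k N) \<longlonglongrightarrow> exp (- a)"
proof (rule tendsto_sandwich)
  have ev: "eventually (\<lambda>N. s N < 1) sequentially" using s by (rule order_tendstoD) simp
  have "exp (- (s N / (1 - s N))) \<le> 1 - s N" if "s N < 1" for N
  proof -
    have "1 / (1 - s N) = 1 + s N / (1 - s N)" using that by (simp add: field_simps)
    also have "\<dots> \<le> exp (s N / (1 - s N))" by (rule exp_ge_add_one_self)
    finally show ?thesis using that by (simp add: exp_minus field_simps)
  qed
  then have "exp (- (real (k N) * s N / (1 - s N))) \<le> (1 - s N) ^ k N" if "s N < 1" for N
    using power_mono[of "exp (- (s N / (1 - s N)))" "1 - s N" "k N"] that
    by (simp add: exp_of_nat_mult[symmetric])
  with ev show "eventually (\<lambda>N. exp (- (real (k N) * s N / (1 - s N))) \<le> (1 - s N) ^ k N) sequentially"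
    by (auto elim: eventually_mono)
  have "(1 - s N) ^ k N \<le> exp (- (real (k N) * s N))" if "s N < 1" for N
    using power_mono[of "1 - s N" "exp (- s N)" "k N"] that exp_ge_add_one_self[of "- s N"]
    by (simp add: exp_of_nat_mult[symmetric])
  with ev show "eventually (\<lambda>N. (1 - s N) ^ k N \<le> exp (- (real (k N) * s N))) sequentially"
    by (auto elim: eventually_mono)
  show "(\<lambda>N. exp (- (real (k N) * s N))) \<longlonglongrightarrow> exp (- a)"
    by (intro tendsto_intros ks)
  have "(\<lambda>N. exp (- (real (k N) * s N / (1 - s N)))) \<longlonglongrightarrow> exp (- (a / (1 - 0)))"
    by (intro tendsto_intros ks s) simp
  then show "(\<lambda>N. exp (- (real (k N) * s N / (1 - s N)))) \<longlonglongrightarrow> exp (- a)" by simp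
qed

lemma falling_eq_fact_div: "k \<le> n \<Longrightarrow> falling n k = fact n / fact (n - k)"
proof (induction k)
  case 0 then show ?case by (simp add: falling_def)
next
  case (Suc k)
  then have "n - k = Suc (n - Suc k)" by simp
  then have "fact (n - k) = (real n - real k) * fact (n - Suc k)"
    using Suc.prems by (simp only: fact_Suc) (simp add: of_nat_diff)
  moreover have "real n - real k \<noteq> 0" using Suc.prems by simp
  ultimately show ?case using Suc by (simp add: falling_Suc)
qed

lemma falling_le_power: "k \<le> n \<Longrightarrow> falling n k \<le> real n ^ k"
proof -
  assume "k \<le> n"
  then have "falling n k \<le> (\<Prod>j<k. real n)" unfolding falling_def by (intro prod_mono) auto
  then show ?thesis by simp
qed

lemma falling_div_power_tendsto: "(\<lambda>N. falling N k / real N ^ k) \<longlonglongrightarrow> 1"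
proof -
  have "(\<lambda>N. (real N - real j) / real N) \<longlonglongrightarrow> 1" for j
  proof (rule Lim_transform_eventually)
    have "(\<lambda>N. 1 - real j / real N) \<longlonglongrightarrow> 1 - 0"
      by (intro tendsto_intros lim_const_over_n)
    then show "(\<lambda>N. 1 - real j / real N) \<longlonglongrightarrow> 1" by simp
    show "eventually (\<lambda>N. 1 - real j / real N = (real N - real j) / real N) sequentially"
      using eventually_gt_at_top[of 0] by eventually_elim (simp add: field_simps)
  qed
  then have "(\<lambda>N. \<Prod>j<k. (real N - real j) / real N) \<longlonglongrightarrow> (\<Prod>j<k. 1)" by (intro tendsto_prod)
  then show ?thesis by (simp add: falling_def prod_dividef)
qed

abbreviation (input) drop_last :: "('d option \<Rightarrow> nat) \<Rightarrow> 'd \<Rightarrow> nat" where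
  "drop_last z \<equiv> \<lambda>i. z (Some i)"

lemma prod_option: "(\<Prod>j\<in>UNIV. f (j :: 'd::finite option)) = f None * (\<Prod>i\<in>UNIV. f (Some i))"
  by (simp add: UNIV_option_conv prod.reindex)

text \<open>On the support the last entry must be N - |x|, so the fibre over x has at most one point
  of positive mass. The quotient N! / (N - |x|)! becomes a falling factorial.\<close>

lemma pmf_drop_last_multinomial:
  fixes p :: "'d::finite \<Rightarrow> real"
  assumes p: "\<And>i. 0 \<le> p i" "total p \<le> 1"
  shows "pmf (map_pmf drop_last (multinomial_pmf N (append_last p (1 - total p)))) x
     = (if total x \<le> N then falling N (total x) * (1 - total p) ^ (N - total x) * (\<Prod>i\<in>UNIV. p i ^ x i / fact (x i)) else 0)"
proof -
  let ?q = "append_last p (1 - total p)" and ?a = "append_last x (N - total x)"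
  let ?P = "multinomial_pmf N ?q"
  have q: "0 \<le> ?q j" for j using p by (auto simp: append_last_def split: option.split)
  have tq: "total ?q = 1" by (simp add: total_append_last)
  note pmf = pmf_multinomial[of ?q, OF q tq]
  have supp: "total z = N" if "z \<in> set_pmf ?P" for z
    using that by (auto simp: set_pmf_iff pmf multinomial_mass_def split: if_splits)
  have eq: "(drop_last -` {x}) \<inter> set_pmf ?P = (if total x \<le> N then {?a} \<inter> set_pmf ?P else {})"
  proof -
    have Int_eq: "A \<inter> S = (if b then {a} \<inter> S else {})"
      if "\<And>z. z \<in> A \<Longrightarrow> z \<in> S \<Longrightarrow> z = a \<and> b" "a \<in> A" for A S :: "'z set" and a b
      using that by auto
    show ?thesis
    proof (rule Int_eq)
      fix z assume z: "z \<in> drop_last -` {x}" "z \<in> set_pmf ?P"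
      then have x: "drop_last z = x" by simp
      have zx: "z None + total x = N"
        unfolding x[symmetric] using supp[OF z(2)] total_option[of z] by simp
      have "z j = ?a j" for j
        using zx fun_cong[OF x] by (cases j) (auto simp: append_last_def)
      with zx show "z = ?a \<and> total x \<le> N" by auto
    qed (simp add: append_last_def)
  qed
  have "pmf (map_pmf drop_last ?P) x = measure ?P ((drop_last -` {x}) \<inter> set_pmf ?P)"
    by (simp add: pmf_map measure_Int_set_pmf)
  also have "\<dots> = (if total x \<le> N then pmf ?P ?a else 0)"
    unfolding eq by (simp add: measure_Int_set_pmf measure_pmf_single)
  also have "\<dots> = (if total x \<le> N then falling N (total x) * (1 - total p) ^ (N - total x) * (\<Prod>i\<in>UNIV. p i ^ x i / fact (x i)) else 0)"
    unfolding pmf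
    by (simp add: multinomial_mass_def total_append_last prod_option falling_eq_fact_div)
       (simp add: append_last_def)
  finally show ?thesis .
qed

locale poisson_limit =
  fixes p :: "nat \<Rightarrow> 'd::finite \<Rightarrow> real" and \<mu> :: "'d \<Rightarrow> real"
  assumes \<mu>: "\<And>i. 0 < \<mu> i"
    and p_nonneg: "\<And>N i. 0 \<le> p N i"
    and p_total: "\<And>N. total (p N) \<le> 1"
    and p_lim: "\<And>i. (\<lambda>N. p N i) \<longlonglongrightarrow> 0"
    and Np_lim: "\<And>i. (\<lambda>N. real N * p N i) \<longlonglongrightarrow> \<mu> i"
begin

definition M :: "nat \<Rightarrow> ('d option \<Rightarrow> nat) pmf" where
  "M N = multinomial_pmf N (append_last (p N) (1 - total (p N)))"

text \<open>The power N^|x| is moved from the falling factorial into the product, so that each of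
  the three factors has its own limit.\<close>

lemma pmf_drop_last_M:
  assumes "total x \<le> N" "0 < N"
  shows "pmf (map_pmf drop_last (M N)) x = falling N (total x) / real N ^ total x
     * (1 - total (p N)) ^ (N - total x) * (\<Prod>i\<in>UNIV. (real N * p N i) ^ x i / fact (x i))"
proof -
  have "(\<Prod>i\<in>UNIV. (real N * p N i) ^ x i / fact (x i)) = real N ^ total x * (\<Prod>i\<in>UNIV. p N i ^ x i / fact (x i))"
    by (simp add: power_mult_distrib prod.distrib power_sum flip: times_divide_eq_right)
  then show ?thesis
    using assms unfolding M_def pmf_drop_last_multinomial[OF p_nonneg p_total] by simp
qed

lemma pmf_drop_last_M_tendsto:
  "(\<lambda>N. pmf (map_pmf drop_last (M N)) x) \<longlonglongrightarrow> pmf (product_poisson \<mu>) x"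
proof (rule Lim_transform_eventually)
  have "(\<lambda>N. total (p N)) \<longlonglongrightarrow> (\<Sum>i::'d\<in>UNIV. 0)" by (intro tendsto_sum p_lim)
  then have s: "(\<lambda>N. total (p N)) \<longlonglongrightarrow> 0" by simp
  \<comment> \<open>Eventually (N - |x|) |p| is N |p| minus |x| |p|, and the correction tends to
    0.\<close>
  have "(\<lambda>N. (\<Sum>i\<in>UNIV. real N * p N i) - real (total x) * total (p N)) \<longlonglongrightarrow> total \<mu> - real (total x) * 0"
    by (intro tendsto_intros Np_lim s)
  moreover have "eventually (\<lambda>N. (\<Sum>i\<in>UNIV. real N * p N i) - real (total x) * total (p N)
        = real (N - total x) * total (p N)) sequentially"
    using eventually_ge_at_top[of "total x"]
    by eventually_elim (simp add: of_nat_diff left_diff_distrib del: of_nat_sum flip: sum_distrib_left)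
  ultimately have "(\<lambda>N. real (N - total x) * total (p N)) \<longlonglongrightarrow> total \<mu> - real (total x) * 0"
    by (rule Lim_transform_eventually)
  then have "(\<lambda>N. real (N - total x) * total (p N)) \<longlonglongrightarrow> total \<mu>" by (simp only: mult_zero_right diff_zero)
  then have e: "(\<lambda>N. (1 - total (p N)) ^ (N - total x)) \<longlonglongrightarrow> exp (- total \<mu>)"
    by (rule power_one_minus_tendsto_exp[OF s])
  have "(\<lambda>N. falling N (total x) / real N ^ total x
     * (1 - total (p N)) ^ (N - total x) * (\<Prod>i\<in>UNIV. (real N * p N i) ^ x i / fact (x i)))
     \<longlonglongrightarrow> 1 * exp (- total \<mu>) * (\<Prod>i\<in>UNIV. \<mu> i ^ x i / fact (x i))"
    by (intro tendsto_mult tendsto_prod tendsto_divide tendsto_power Np_lim e falling_div_power_tendsto tendsto_const) simp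
  also have "1 * exp (- total \<mu>) * (\<Prod>i\<in>UNIV. \<mu> i ^ x i / fact (x i)) = pmf (product_poisson \<mu>) x"
    unfolding pmf_product_poisson[of \<mu>, OF \<mu>]
    by (simp add: exp_sum sum_negf[symmetric] prod.distrib flip: times_divide_eq_right)
  finally show "(\<lambda>N. falling N (total x) / real N ^ total x
     * (1 - total (p N)) ^ (N - total x) * (\<Prod>i\<in>UNIV. (real N * p N i) ^ x i / fact (x i)))
     \<longlonglongrightarrow> pmf (product_poisson \<mu>) x" .
  show "eventually (\<lambda>N. falling N (total x) / real N ^ total x
     * (1 - total (p N)) ^ (N - total x) * (\<Prod>i\<in>UNIV. (real N * p N i) ^ x i / fact (x i))
     = pmf (map_pmf drop_last (M N)) x) sequentially"
    using eventually_ge_at_top[of "Suc (total x)"] by eventually_elim (simp add: pmf_drop_last_M)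
qed

text \<open>Each N p_i converges, hence is bounded by some c_i for all N at once; the falling
  factorial divided by N^|x| and the power of 1 - |p| are at most 1.\<close>

lemma pmf_drop_last_M_bound:
  obtains c where "\<And>i. 0 < c i"
    "\<And>N x. pmf (map_pmf drop_last (M N)) x \<le> (\<Prod>i\<in>UNIV. c i ^ x i / fact (x i))"
proof -
  have "\<exists>c>0. \<forall>N. norm (real N * p N i) \<le> c" for i
    using convergentI[OF Np_lim, THEN convergent_imp_Bseq] by (auto simp: Bseq_def)
  then obtain c where c: "\<And>i. 0 < c i" "\<And>i N. norm (real N * p N i) \<le> c i" by metis
  have "pmf (map_pmf drop_last (M N)) x \<le> (\<Prod>i\<in>UNIV. c i ^ x i / fact (x i))" for N x
  proof (cases "total x \<le> N \<and> 0 < N")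
    case True
    have "falling N (total x) / real N ^ total x * (1 - total (p N)) ^ (N - total x) \<le> 1 * 1"
      using True falling_le_power[of "total x" N] p_total[of N]
      by (intro mult_mono power_le_one) (auto simp: divide_le_eq_1 sum_nonneg p_nonneg)
    moreover have "(\<Prod>i\<in>UNIV. (real N * p N i) ^ x i / fact (x i)) \<le> (\<Prod>i\<in>UNIV. c i ^ x i / fact (x i))"
      using c(2)[of N] p_nonneg[of N]
      by (intro prod_mono conjI divide_right_mono power_mono divide_nonneg_pos) auto
    moreover have "0 \<le> (\<Prod>i\<in>UNIV. (real N * p N i) ^ x i / fact (x i))"
      using p_nonneg[of N] by (intro prod_nonneg) auto
    ultimately have "falling N (total x) / real N ^ total x * (1 - total (p N)) ^ (N - total x)
        * (\<Prod>i\<in>UNIV. (real N * p N i) ^ x i / fact (x i)) \<le> 1 * (\<Prod>i\<in>UNIV. c i ^ x i / fact (x i))"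
      by (intro mult_mono) auto
    then show ?thesis using True by (simp add: pmf_drop_last_M)
  next
    \<comment> \<open>Either N = 0 and x = 0, where the bound equals 1, or |x| > N, where the mass
      is 0.\<close>
    case False
    show ?thesis
    proof (cases "total x \<le> N")
      case True
      with False have "N = 0" "total x = 0" by auto
      moreover from this(2) have "x = (\<lambda>_. 0)" by auto
      ultimately show ?thesis by (simp add: pmf_le_1)
    next
      case False
      then have "pmf (map_pmf drop_last (M N)) x = 0"
        unfolding M_def pmf_drop_last_multinomial[OF p_nonneg p_total] by simp
      then show ?thesis using c(1) by (auto intro!: prod_nonneg simp: less_imp_le)
    qed
  qed
  with c(1) show ?thesis by (rule that)
qed

lemma expectation_M_tendsto:
  fixes f :: "('d \<Rightarrow> nat) \<Rightarrow> real"
  assumes f: "\<And>x. \<bar>f x\<bar> \<le> K * (\<Prod>i\<in>UNIV. 4 ^ x i)"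
  shows "(\<lambda>N. measure_pmf.expectation (M N) (\<lambda>z. f (drop_last z))) \<longlonglongrightarrow> measure_pmf.expectation (product_poisson \<mu>) f"
proof -
  obtain c where c: "\<And>i. 0 < c i"
    "\<And>N x. pmf (map_pmf drop_last (M N)) x \<le> (\<Prod>i\<in>UNIV. c i ^ x i / fact (x i))"
    by (rule pmf_drop_last_M_bound) blast
  \<comment> \<open>The mass bound times the growth bound: up to a constant a product Poisson mass
    with parameters 4 c_i, hence summable.\<close>
  define w where "w x = K * (\<Prod>i\<in>UNIV. (4 * c i) ^ x i / fact (x i))" for x :: "'d \<Rightarrow> nat"
  have w_eq: "w x = K * (\<Prod>i\<in>UNIV. exp (4 * c i)) * pmf (product_poisson (\<lambda>i. 4 * c i)) x" for x
  proof -
    have "pmf (product_poisson (\<lambda>i. 4 * c i)) x = (\<Prod>i\<in>UNIV. exp (- (4 * c i)) * (4 * c i) ^ x i / fact (x i))"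
      by (rule pmf_product_poisson) (simp add: c(1))
    then have "(\<Prod>i\<in>UNIV. exp (4 * c i)) * pmf (product_poisson (\<lambda>i. 4 * c i)) x
        = (\<Prod>i\<in>UNIV. (exp (4 * c i) * exp (- (4 * c i))) * ((4 * c i) ^ x i / fact (x i)))"
      by (simp add: prod.distrib[symmetric] mult.assoc)
    also have "\<dots> = (\<Prod>i\<in>UNIV. (4 * c i) ^ x i / fact (x i))"
      by (simp only: exp_minus_inverse mult_1_left)
    finally show ?thesis unfolding w_def by (simp add: mult.assoc)
  qed
  have int_w: "integrable (count_space UNIV) w"
    unfolding w_eq[abs_def] by (intro integrable_mult_right integrable_pmf)
  have bound: "norm (pmf (map_pmf drop_last (M N)) x * f x) \<le> w x" for N x
  proof -
    have "norm (pmf (map_pmf drop_last (M N)) x * f x)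
        \<le> (\<Prod>i\<in>UNIV. c i ^ x i / fact (x i)) * (K * (\<Prod>i\<in>UNIV. 4 ^ x i))"
      unfolding real_norm_def abs_mult abs_of_nonneg[OF pmf_nonneg]
      by (rule mult_mono[OF c(2) f]) (auto intro!: prod_nonneg simp: c(1) less_imp_le)
    also have "\<dots> = w x"
      by (simp add: w_def power_mult_distrib prod.distrib flip: times_divide_eq_right)
    finally show ?thesis .
  qed
  have "(\<lambda>N. \<integral>x. pmf (map_pmf drop_last (M N)) x * f x \<partial>count_space UNIV)
      \<longlonglongrightarrow> (\<integral>x. pmf (product_poisson \<mu>) x * f x \<partial>count_space UNIV)"
    by (rule integral_dominated_convergence[OF _ _ int_w])
       (auto intro!: tendsto_mult pmf_drop_last_M_tendsto bound[simplified])
  then show ?thesis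
    unfolding expectation_eq_integral_count_space[symmetric] by simp
qed

lemma weakly_converges_drop_last:
  fixes Ms :: "nat \<Rightarrow> 'w measure" and X :: "nat \<Rightarrow> 'w \<Rightarrow> 'd option \<Rightarrow> nat"
  assumes X: "\<And>N. X N \<in> measurable (Ms N) (count_space UNIV)"
    and dist: "\<And>N. distr (Ms N) (count_space UNIV) (X N) = measure_pmf (M N)"
  shows "weakly_converges (\<lambda>N. distr (Ms N) borel (\<lambda>\<omega>. real_vec (drop_last (X N \<omega>))))
           (distr (measure_pmf (product_poisson \<mu>)) borel real_vec)"
  unfolding weakly_converges_def
proof (intro allI impI)
  fix f :: "real ^ 'd \<Rightarrow> real"
  assume cont: "continuous_on UNIV f" and bdd: "bounded (range f)"
  have [measurable]: "f \<in> borel_measurable borel" using cont by (rule borel_measurable_continuous_onI)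
  obtain K where K: "\<And>x. \<bar>f x\<bar> \<le> K" using bdd unfolding bounded_iff by auto
  have "\<bar>f (real_vec x)\<bar> \<le> K * (\<Prod>i\<in>UNIV. 4 ^ x i)" for x :: "'d \<Rightarrow> nat"
  proof -
    have "(1::real) \<le> (\<Prod>i\<in>UNIV. 4 ^ x i)" by (rule prod_ge_1) simp
    moreover have "0 \<le> K" using K[of 0] by linarith
    ultimately have "K * 1 \<le> K * (\<Prod>i\<in>UNIV. 4 ^ x i)" by (intro mult_left_mono)
    with K[of "real_vec x"] show ?thesis by simp
  qed
  then have "(\<lambda>N. measure_pmf.expectation (M N) (\<lambda>z. f (real_vec (drop_last z))))
      \<longlonglongrightarrow> measure_pmf.expectation (product_poisson \<mu>) (\<lambda>x. f (real_vec x))"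
    by (rule expectation_M_tendsto)
  moreover have "measure_pmf.expectation (M N) (\<lambda>z. f (real_vec (drop_last z)))
      = (\<integral>v. f v \<partial>distr (Ms N) borel (\<lambda>\<omega>. real_vec (drop_last (X N \<omega>))))" for N
  proof -
    have meas: "(\<lambda>\<omega>. real_vec (drop_last (X N \<omega>))) \<in> measurable (Ms N) borel"
      by (rule measurable_compose[OF X]) simp
    have "measure_pmf.expectation (M N) (\<lambda>z. f (real_vec (drop_last z)))
        = (\<integral>\<omega>. f (real_vec (drop_last (X N \<omega>))) \<partial>Ms N)"
      unfolding dist[symmetric] by (rule integral_distr[OF X]) simp
    also have "\<dots> = (\<integral>v. f v \<partial>distr (Ms N) borel (\<lambda>\<omega>. real_vec (drop_last (X N \<omega>))))"
      by (rule integral_distr[OF meas, symmetric]) simp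
    finally show ?thesis .
  qed
  moreover have "measure_pmf.expectation (product_poisson \<mu>) (\<lambda>x. f (real_vec x))
      = (\<integral>v. f v \<partial>distr (measure_pmf (product_poisson \<mu>)) borel real_vec)"
    by (rule integral_distr[symmetric]) simp_all
  ultimately show "(\<lambda>N. \<integral>v. f v \<partial>distr (Ms N) borel (\<lambda>\<omega>. real_vec (drop_last (X N \<omega>))))
      \<longlonglongrightarrow> (\<integral>v. f v \<partial>distr (measure_pmf (product_poisson \<mu>)) borel real_vec)" by simp
qed

end

section \<open>Convergence of the multinomial kernels\<close>

text \<open>Let \<epsilon> be the sum of all entries of |G - I|. No bound on the solutions is
  assumed, so one is derived: |a| \<le> |v| + \<epsilon> |a| in the l1 norm, and once \<epsilon> <
  1/2 this gives |a| \<le> 2 |v|. Then v - a is at most 2 \<epsilon> |v|.\<close>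

lemma perturbed_identity_solution_tendsto:
  fixes G :: "nat \<Rightarrow> 'b \<Rightarrow> 'b \<Rightarrow> real" and a :: "nat \<Rightarrow> 'b \<Rightarrow> real"
  assumes D: "finite D" and l: "l \<in> D"
    and G: "\<And>l m. l \<in> D \<Longrightarrow> m \<in> D \<Longrightarrow> (\<lambda>N. G N l m) \<longlonglongrightarrow> (if l = m then 1 else 0)"
    and eq: "eventually (\<lambda>N. \<forall>l\<in>D. (\<Sum>m\<in>D. G N l m * a N m) = v l) sequentially"
  shows "(\<lambda>N. a N l) \<longlonglongrightarrow> v l"
proof -
  define I where "I l m = (if l = m then 1 else 0 :: real)" for l m :: 'b
  define \<epsilon> where "\<epsilon> N = (\<Sum>l\<in>D. \<Sum>m\<in>D. \<bar>G N l m - I l m\<bar>)" for N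
  define s where "s N = (\<Sum>m\<in>D. \<bar>a N m\<bar>)" for N
  define V where "V = (\<Sum>m\<in>D. \<bar>v m\<bar>)"
  have "\<epsilon> \<longlonglongrightarrow> (\<Sum>l\<in>D. \<Sum>m\<in>D. \<bar>I l m - I l m\<bar>)"
    unfolding \<epsilon>_def
    by (intro tendsto_sum tendsto_rabs tendsto_diff tendsto_const) (simp add: G I_def)
  then have \<epsilon>: "\<epsilon> \<longlonglongrightarrow> 0" by simp
  have s_nonneg: "0 \<le> s N" for N by (simp add: s_def sum_nonneg)
  have diff: "\<bar>v l - a N l\<bar> \<le> (\<Sum>m\<in>D. \<bar>G N l m - I l m\<bar>) * s N"
    if "\<forall>l\<in>D. (\<Sum>m\<in>D. G N l m * a N m) = v l" "l \<in> D" for N l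
  proof -
    have "(\<Sum>m\<in>D. I l m * a N m) = a N l"
      using D that(2) by (simp add: I_def if_distrib[of "\<lambda>x. x * _"] cong: if_cong)
    then have "v l - a N l = (\<Sum>m\<in>D. (G N l m - I l m) * a N m)"
      using that by (simp add: left_diff_distrib sum_subtractf)
    also have "\<bar>\<dots>\<bar> \<le> (\<Sum>m\<in>D. \<bar>G N l m - I l m\<bar> * s N)"
    proof (rule order_trans[OF sum_abs], rule sum_mono)
      fix m assume "m \<in> D"
      then have "\<bar>a N m\<bar> \<le> s N" unfolding s_def using D by (intro member_le_sum) auto
      then show "\<bar>(G N l m - I l m) * a N m\<bar> \<le> \<bar>G N l m - I l m\<bar> * s N"
        unfolding abs_mult by (intro mult_left_mono) auto
    qed
    finally show ?thesis by (simp add: sum_distrib_right)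
  qed
  have ev: "eventually (\<lambda>N. \<bar>v l - a N l\<bar> \<le> \<epsilon> N * (2 * V)) sequentially"
    using eq order_tendstoD(2)[OF \<epsilon>, of "1/2", simplified]
  proof eventually_elim
    case (elim N)
    have "s N \<le> V + (\<Sum>l\<in>D. \<bar>v l - a N l\<bar>)"
      unfolding s_def V_def sum.distrib[symmetric] by (intro sum_mono) linarith
    also have "(\<Sum>l\<in>D. \<bar>v l - a N l\<bar>) \<le> (\<Sum>l\<in>D. (\<Sum>m\<in>D. \<bar>G N l m - I l m\<bar>) * s N)"
      by (intro sum_mono diff elim(1))
    also have "\<dots> = \<epsilon> N * s N" by (simp add: \<epsilon>_def sum_distrib_right)
    also have "\<epsilon> N * s N \<le> 1/2 * s N" using elim(2) s_nonneg by (intro mult_right_mono) auto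
    finally have sV: "s N \<le> 2 * V" by simp
    have "(\<Sum>m\<in>D. \<bar>G N l m - I l m\<bar>) \<le> \<epsilon> N"
      unfolding \<epsilon>_def using D l by (intro member_le_sum[where f = "\<lambda>l. \<Sum>m\<in>D. \<bar>G N l m - I l m\<bar>"]) (auto intro: sum_nonneg)
    then have "(\<Sum>m\<in>D. \<bar>G N l m - I l m\<bar>) * s N \<le> \<epsilon> N * (2 * V)"
      using sV s_nonneg[of N] by (intro mult_mono) (auto simp: \<epsilon>_def intro!: sum_nonneg)
    then show ?case using diff[OF elim(1) l] by linarith
  qed
  have "(\<lambda>N. \<epsilon> N * (2 * V)) \<longlonglongrightarrow> 0 * (2 * V)" by (intro tendsto_intros \<epsilon>)
  then have "(\<lambda>N. v l - a N l) \<longlonglongrightarrow> 0"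
    using ev by (intro tendsto_rabs_zero_cancel[OF tendsto_sandwich[OF always_eventually ev tendsto_const]]) auto
  then have "(\<lambda>N. v l - (v l - a N l)) \<longlonglongrightarrow> v l - 0" by (intro tendsto_intros)
  then show ?thesis by simp
qed

text \<open>In terms of an arbitrary basis \<open>g\<close>, the coefficients of the kernel \<open>K(\<cdot>, y)\<close> solve a linear system
  with the Gram matrix of \<open>g\<close>, by the reproducing property.\<close>

lemma kernel_coefficients:
  assumes Q: "orthonormal_on P A Q" and A: "finite A" and fin: "finite (set_pmf P)"
    and Qg: "\<And>j. j \<in> A \<Longrightarrow> span_on (set_pmf P) g D (Q j)"
    and gQ: "\<And>l. l \<in> D \<Longrightarrow> span_on (set_pmf P) Q A (g l)"
    and y: "y \<in> set_pmf P"
  shows "\<exists>a. (\<forall>l\<in>D. (\<Sum>m\<in>D. measure_pmf.expectation P (\<lambda>z. g l z * g m z) * a m) = g l y) \<and>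
     (\<forall>x\<in>set_pmf P. (\<Sum>j\<in>A. Q j x * Q j y) = (\<Sum>m\<in>D. a m * g m x))"
proof -
  let ?E = "measure_pmf.expectation P"
  note int = integrable_measure_pmf_finite[OF fin]
  define h where "h x = (\<Sum>j\<in>A. Q j y * Q j x)" for x
  have "span_on (set_pmf P) g D h"
    unfolding h_def[abs_def] by (intro span_on_sum span_on_scale Qg)
  then obtain a where a: "\<And>x. x \<in> set_pmf P \<Longrightarrow> h x = (\<Sum>m\<in>D. a m * g m x)"
    unfolding span_on_def by blast
  have "(\<Sum>m\<in>D. ?E (\<lambda>z. g l z * g m z) * a m) = g l y" if l: "l \<in> D" for l
  proof -
    have "(\<Sum>m\<in>D. ?E (\<lambda>z. g l z * g m z) * a m) = ?E (\<lambda>z. \<Sum>m\<in>D. g l z * g m z * a m)"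
      by (subst Bochner_Integration.integral_sum) (auto intro: int)
    also have "\<dots> = ?E (\<lambda>z. g l z * h z)"
      by (intro integral_cong_AE) (auto simp: AE_measure_pmf_iff a sum_distrib_left mult_ac)
    also have "\<dots> = ?E (\<lambda>z. \<Sum>j\<in>A. Q j y * (g l z * Q j z))"
      by (simp add: h_def sum_distrib_left mult_ac)
    also have "\<dots> = (\<Sum>j\<in>A. Q j y * ?E (\<lambda>z. g l z * Q j z))"
      by (subst Bochner_Integration.integral_sum) (auto intro: int)
    also have "\<dots> = g l y"
      using span_on_orthonormal_expansion[OF Q A gQ[OF l] y] by (simp add: mult.commute)
    finally show ?thesis .
  qed
  moreover have "(\<Sum>j\<in>A. Q j x * Q j y) = (\<Sum>m\<in>D. a m * g m x)" if "x \<in> set_pmf P" for x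
    using a[OF that] by (simp add: h_def mult.commute)
  ultimately show ?thesis by blast
qed

lemma prod_basis_drop_last: "prod_basis Some g m z = prod_basis id g m (drop_last z)"
  by (simp add: prod_basis_def)

context poisson_limit
begin

text \<open>Exponential growth of a product of two basis elements lets the expectation pass to the
  Poisson limit, where orthonormality holds. \<open>K i\<close> collects the two normalisations and
  the two factors exp (\<mu> i).\<close>

lemma gram_charlier_basis_tendsto:
  "(\<lambda>N. measure_pmf.expectation (M N) (\<lambda>z. charlier_basis Some \<mu> l z * charlier_basis Some \<mu> m z))
     \<longlonglongrightarrow> (if l = m then 1 else 0)"
proof -
  define K where "K i = sqrt (fact (l i) / \<mu> i ^ l i) * sqrt (fact (m i) / \<mu> i ^ m i) * (exp (\<mu> i) * exp (\<mu> i))" for i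
  have bound: "\<bar>charlier_basis id \<mu> l x * charlier_basis id \<mu> m x\<bar> \<le> (\<Prod>i\<in>UNIV. K i) * (\<Prod>i\<in>UNIV. 4 ^ x i)" for x
  proof -
    have "\<bar>normalized_charlier (\<mu> i) (l i) (x i) * normalized_charlier (\<mu> i) (m i) (x i)\<bar> \<le> K i * 4 ^ x i" for i
    proof -
      let ?r = "sqrt (fact (l i) / \<mu> i ^ l i) * sqrt (fact (m i) / \<mu> i ^ m i)"
      have r: "0 \<le> ?r" using \<mu>[of i] by simp
      have "\<bar>normalized_charlier (\<mu> i) (l i) (x i) * normalized_charlier (\<mu> i) (m i) (x i)\<bar>
          = ?r * \<bar>scaled_charlier (\<mu> i) (l i) (x i) * scaled_charlier (\<mu> i) (m i) (x i)\<bar>"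
        unfolding normalized_charlier_def using r \<mu>[of i] by (simp add: abs_mult)
      also have "\<dots> \<le> ?r * (exp (\<mu> i) * exp (\<mu> i) * (2 ^ x i * 2 ^ x i))"
        by (rule mult_left_mono[OF abs_scaled_charlier_mult_le[OF \<mu>] r])
      also have "\<dots> = K i * 4 ^ x i" by (simp add: K_def mult.assoc flip: power_mult_distrib)
      finally show ?thesis .
    qed
    then show ?thesis
      unfolding prod_basis_def prod.distrib[symmetric] id_apply abs_prod by (intro prod_mono) auto
  qed
  show ?thesis
    unfolding prod_basis_drop_last expectation_charlier_basis[of \<mu> l m, OF \<mu>, symmetric]
    by (rule expectation_M_tendsto[OF bound])
qed

text \<open>For small N some probabilities may be 0 and the support a proper subset of the simplex.
  Positivity of the limits of N p_i and |p| tending to 0 make all d + 1 probabilities positive in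
  the end.\<close>

lemma set_pmf_M_eventually: "eventually (\<lambda>N. set_pmf (M N) = {z. total z = N}) sequentially"
proof -
  have "eventually (\<lambda>N. \<forall>i\<in>UNIV. 0 < real N * p N i) sequentially"
    by (intro eventually_ball_finite ballI order_tendstoD(1)[OF Np_lim \<mu>]) simp
  moreover have "(\<lambda>N. total (p N)) \<longlonglongrightarrow> (\<Sum>i::'d\<in>UNIV. 0)" by (intro tendsto_sum p_lim)
  then have "eventually (\<lambda>N. total (p N) < 1) sequentially"
    by (intro order_tendstoD(2)[of _ 0]) simp_all
  ultimately show ?thesis
  proof eventually_elim
    case (elim N)
    let ?q = "append_last (p N) (1 - total (p N))"
    have q: "0 < ?q j" for j
      using elim by (auto simp: append_last_def zero_less_mult_iff split: option.split)
    have "pmf (M N) z = multinomial_mass N ?q z" for z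
      unfolding M_def by (rule pmf_multinomial) (simp_all add: less_imp_le q total_append_last)
    moreover have "(\<Prod>j\<in>UNIV. ?q j ^ z j / fact (z j)) \<noteq> 0" for z
      using q by (intro less_imp_neq[symmetric] prod_pos) simp
    ultimately have "pmf (M N) z \<noteq> 0 \<longleftrightarrow> total z = N" for z
      unfolding multinomial_mass_def by (cases "total z = N") simp_all
    then show ?case unfolding set_eq_iff set_pmf_iff mem_Collect_eq by blast
  qed
qed

text \<open>The sets \<open>Q N\<close> are arbitrary and unrelated for different N. The kernel with
  y fixed is re-expanded in the Charlier products, whose values at x and y do not change with N, so
  only its coefficients have to converge.\<close>

lemma cumulative_kernel_tendsto:
  assumes Q: "eventually (\<lambda>N. complete_orthonormal (M N) {m :: 'd \<Rightarrow> nat. total m \<le> N} (Q N)) sequentially"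
  shows "(\<lambda>N. \<Sum>m | m \<in> {m. total m \<le> N} \<and> total m \<le> k.
            Q N m (append_last x (N - total x)) * Q N m (append_last y (N - total y)))
     \<longlonglongrightarrow> (\<Sum>m | total m \<le> k. charlier_basis id \<mu> m x * charlier_basis id \<mu> m y)"
proof -
  let ?D = "{m :: 'd \<Rightarrow> nat. total m \<le> k}" and ?g = "charlier_basis Some \<mu>"
  let ?A = "\<lambda>N. {m :: 'd \<Rightarrow> nat. m \<in> {m. total m \<le> N} \<and> total m \<le> k}"
  let ?x = "\<lambda>N. append_last x (N - total x)" and ?y = "\<lambda>N. append_last y (N - total y)"
  let ?K = "\<lambda>N. \<Sum>m\<in>?A N. Q N m (?x N) * Q N m (?y N)"
  have g_append: "?g m (append_last z b) = charlier_basis id \<mu> m z" for m z b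
    by (simp add: prod_basis_def append_last_def)
  have "eventually (\<lambda>N. \<exists>a. (\<forall>l\<in>?D. (\<Sum>m\<in>?D. measure_pmf.expectation (M N) (\<lambda>z. ?g l z * ?g m z) * a m)
          = charlier_basis id \<mu> l y) \<and> ?K N = (\<Sum>m\<in>?D. a m * charlier_basis id \<mu> m x)) sequentially"
    using Q set_pmf_M_eventually eventually_ge_at_top[of "total x"] eventually_ge_at_top[of "total y"]
  proof eventually_elim
    case (elim N)
    note supp = elim(2)
    have x: "?x N \<in> set_pmf (M N)" and y: "?y N \<in> set_pmf (M N)"
      using elim by (simp_all add: supp total_append_last)
    have "\<exists>a. (\<forall>l\<in>?D. (\<Sum>m\<in>?D. measure_pmf.expectation (M N) (\<lambda>z. ?g l z * ?g m z) * a m) = ?g l (?y N)) \<and>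
       (\<forall>x\<in>set_pmf (M N). (\<Sum>j\<in>?A N. Q N j x * Q N j (?y N)) = (\<Sum>m\<in>?D. a m * ?g m x))"
    proof (rule kernel_coefficients[OF _ _ _ _ _ y])
      show "orthonormal_on (M N) (?A N) (Q N)"
        by (rule orthonormal_on_subset[OF complete_orthonormal_orthonormal_on[OF elim(1)]]) auto
      show "finite (?A N)" by (rule finite_index_le)
      show "finite (set_pmf (M N))" by (simp add: supp)
    next
      fix j assume j: "j \<in> ?A N"
      then have "poly_le_on (set_pmf (M N)) k (Q N j)"
        by (intro poly_le_on_mono[OF complete_orthonormal_poly_le_on[OF elim(1)]]) auto
      then show "span_on (set_pmf (M N)) ?g ?D (Q N j)"
        by (intro poly_le_on_simplex_imp_span_on_prod_basis[where N = N] three_term_normalized_charlier \<mu>)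
           (auto simp: supp)
    next
      fix l assume l: "l \<in> ?D"
      have "poly_le_on (set_pmf (M N)) (total l) (?g l)"
        by (intro poly_le_on_prod_basis three_term_normalized_charlier \<mu>)
      then show "span_on (set_pmf (M N)) (Q N) (?A N) (?g l)"
        using l by (intro complete_orthonormal_span_on[OF elim(1)]) (auto elim: poly_le_on_mono)
    qed
    then show ?case using x by (auto simp: g_append)
  qed
  \<comment> \<open>The coefficients found for each large N are collected into one sequence.\<close>
  then obtain a where a: "eventually (\<lambda>N. (\<forall>l\<in>?D. (\<Sum>m\<in>?D. measure_pmf.expectation (M N) (\<lambda>z. ?g l z * ?g m z) * a N m)
          = charlier_basis id \<mu> l y) \<and> ?K N = (\<Sum>m\<in>?D. a N m * charlier_basis id \<mu> m x)) sequentially"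
    unfolding eventually_ex by blast
  have "(\<lambda>N. a N l) \<longlonglongrightarrow> charlier_basis id \<mu> l y" if "l \<in> ?D" for l
    by (rule perturbed_identity_solution_tendsto[OF finite_total_le that gram_charlier_basis_tendsto
          eventually_mono[OF a]]) blast
  then have "(\<lambda>N. \<Sum>m\<in>?D. a N m * charlier_basis id \<mu> m x)
      \<longlonglongrightarrow> (\<Sum>m\<in>?D. charlier_basis id \<mu> m y * charlier_basis id \<mu> m x)"
    by (intro tendsto_sum tendsto_mult tendsto_const)
  then have "?K \<longlonglongrightarrow> (\<Sum>m\<in>?D. charlier_basis id \<mu> m y * charlier_basis id \<mu> m x)"
    by (rule Lim_transform_eventually) (use a in \<open>auto elim!: eventually_mono\<close>)
  then show ?thesis by (simp add: mult.commute)
qed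

lemma multinomial_kernel_poly_tendsto:
  "(\<lambda>N. multinomial_kernel_poly n (append_last x (N - total x)) (append_last y (N - total y))
      N (append_last (p N) (1 - total (p N)))) \<longlonglongrightarrow> poisson_kernel_poly n x y \<mu>"
proof -
  let ?x = "\<lambda>N. append_last x (N - total x)" and ?y = "\<lambda>N. append_last y (N - total y)"
  \<comment> \<open>An arbitrary choice, meaningful for those N where the support is the full
    simplex, that is, eventually.\<close>
  define Q where "Q N = (SOME Q. complete_orthonormal (M N) {m :: 'd \<Rightarrow> nat. total m \<le> N} Q)" for N
  have Q: "eventually (\<lambda>N. complete_orthonormal (M N) {m :: 'd \<Rightarrow> nat. total m \<le> N} (Q N)) sequentially"
    using set_pmf_M_eventually
  proof eventually_elim
    case (elim N)
    then show ?case unfolding Q_def by (rule someI_ex[OF complete_orthonormal_simplex_exists])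
  qed
  let ?c = "\<lambda>N k. \<Sum>m | m \<in> {m. total m \<le> N} \<and> total m \<le> k. Q N m (?x N) * Q N m (?y N)"
  let ?d = "\<lambda>k. \<Sum>m | total m \<le> k. charlier_basis id \<mu> m x * charlier_basis id \<mu> m y"
  have lim: "(\<lambda>N. ?c N n - (if n = 0 then 0 else ?c N (n - 1))) \<longlonglongrightarrow> ?d n - (if n = 0 then 0 else ?d (n - 1))"
    using cumulative_kernel_tendsto[OF Q, where k = n and x = x and y = y] cumulative_kernel_tendsto[OF Q, where k = "n - 1" and x = x and y = y]
    by (cases "n = 0") (auto intro!: tendsto_diff)
  have d: "poisson_kernel_poly n x y \<mu> = ?d n - (if n = 0 then 0 else ?d (n - 1))"
    using kernel_eq_diff_cumulative[where I = UNIV and n = n and f = "\<lambda>m. charlier_basis id \<mu> m x * charlier_basis id \<mu> m y"]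
    by (simp add: poisson_kernel_poly_eq_sum[of \<mu>, OF \<mu>])
  have "eventually (\<lambda>N. ?c N n - (if n = 0 then 0 else ?c N (n - 1))
      = multinomial_kernel_poly n (?x N) (?y N) N (append_last (p N) (1 - total (p N)))) sequentially"
    using Q set_pmf_M_eventually eventually_ge_at_top[of "total x"] eventually_ge_at_top[of "total y"]
  proof eventually_elim
    case (elim N)
    have "?x N \<in> set_pmf (M N)" "?y N \<in> set_pmf (M N)"
      using elim by (simp_all add: elim(2) total_append_last)
    from reproducing_kernel_eq[OF elim(1) this, of n] show ?case
      unfolding multinomial_kernel_poly_def M_def[symmetric]
      by (simp only: kernel_eq_diff_cumulative[where n = n])
  qed
  from Lim_transform_eventually[OF lim this] show ?thesis unfolding d .
qed

end

theorem theorem3: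
  fixes \<mu> :: "'d::finite \<Rightarrow> real"
  assumes mu_pos: "\<And>i. 0 < \<mu> i"
  shows
    "(\<forall>p :: nat \<Rightarrow> 'd \<Rightarrow> real.
        (\<forall>N i. 0 \<le> p N i) \<and> (\<forall>N. total (p N) \<le> 1) \<and>
        (\<forall>i. (\<lambda>N. p N i) \<longlonglongrightarrow> 0) \<and> (\<forall>i. (\<lambda>N. real N * p N i) \<longlonglongrightarrow> \<mu> i) \<longrightarrow>
        (\<forall>(M :: nat \<Rightarrow> 'w measure) (X :: nat \<Rightarrow> 'w \<Rightarrow> 'd option \<Rightarrow> nat).
           (\<forall>N. prob_space (M N) \<and> X N \<in> measurable (M N) (count_space UNIV) \<and>
                distr (M N) (count_space UNIV) (X N) =
                  measure_pmf (multinomial_pmf N (append_last (p N) (1 - total (p N))))) \<longrightarrow>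
           weakly_converges
             (\<lambda>N. distr (M N) borel (\<lambda>\<omega>. real_vec (\<lambda>i. X N \<omega> (Some i))))
             (distr (measure_pmf (product_poisson \<mu>)) borel real_vec)) \<and>
        (\<forall>(x :: 'd \<Rightarrow> nat) (y :: 'd \<Rightarrow> nat) n.
           (\<lambda>N. multinomial_kernel_poly n
                  (append_last x (N - total x)) (append_last y (N - total y))
                  N (append_last (p N) (1 - total (p N))))
             \<longlonglongrightarrow> poisson_kernel_poly n x y \<mu>))
   \<and> (\<forall>x y. \<forall>\<rho>::real.
        summable (\<lambda>n. \<rho> ^ Suc n * poisson_kernel_poly (Suc n) x y \<mu>) \<and>
        1 + (\<Sum>n. \<rho> ^ Suc n * poisson_kernel_poly (Suc n) x y \<mu>) =
          exp (total \<mu> * \<rho>) *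
          (\<Sum>z | z \<le> x \<and> z \<le> y.
             \<rho> ^ total z * (1 - \<rho>) ^ (total x + total y - 2 * total z) *
             (\<Prod>i\<in>UNIV. falling (x i) (z i) * falling (y i) (z i) / (\<mu> i ^ z i * fact (z i)))) \<and>
        (0 \<le> \<rho> \<and> \<rho> \<le> 1 \<longrightarrow>
          0 \<le> 1 + (\<Sum>n. \<rho> ^ Suc n * poisson_kernel_poly (Suc n) x y \<mu>)))
   \<and> (\<forall>n x y.
        poisson_kernel_poly n x y \<mu> =
          (\<Sum>z | z \<le> x \<and> z \<le> y \<and> total z \<le> n.
             total \<mu> ^ (n - total z) / fact (n - total z) *
             charlier (n - total z) (total x + total y - 2 * total z) (total \<mu>) *
             (\<Prod>i\<in>UNIV. falling (x i) (z i) * falling (y i) (z i) / (\<mu> i ^ z i * fact (z i)))))"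
proof (intro conjI)
  show "\<forall>p :: nat \<Rightarrow> 'd \<Rightarrow> real.
        (\<forall>N i. 0 \<le> p N i) \<and> (\<forall>N. total (p N) \<le> 1) \<and>
        (\<forall>i. (\<lambda>N. p N i) \<longlonglongrightarrow> 0) \<and> (\<forall>i. (\<lambda>N. real N * p N i) \<longlonglongrightarrow> \<mu> i) \<longrightarrow>
        (\<forall>(M :: nat \<Rightarrow> 'w measure) (X :: nat \<Rightarrow> 'w \<Rightarrow> 'd option \<Rightarrow> nat).
           (\<forall>N. prob_space (M N) \<and> X N \<in> measurable (M N) (count_space UNIV) \<and>
                distr (M N) (count_space UNIV) (X N) =
                  measure_pmf (multinomial_pmf N (append_last (p N) (1 - total (p N))))) \<longrightarrow>
           weakly_converges
             (\<lambda>N. distr (M N) borel (\<lambda>\<omega>. real_vec (\<lambda>i. X N \<omega> (Some i))))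
             (distr (measure_pmf (product_poisson \<mu>)) borel real_vec)) \<and>
        (\<forall>(x :: 'd \<Rightarrow> nat) (y :: 'd \<Rightarrow> nat) n.
           (\<lambda>N. multinomial_kernel_poly n
                  (append_last x (N - total x)) (append_last y (N - total y))
                  N (append_last (p N) (1 - total (p N))))
             \<longlonglongrightarrow> poisson_kernel_poly n x y \<mu>)"
  proof (intro allI impI)
    fix p :: "nat \<Rightarrow> 'd \<Rightarrow> real"
    assume "(\<forall>N i. 0 \<le> p N i) \<and> (\<forall>N. total (p N) \<le> 1) \<and>
        (\<forall>i. (\<lambda>N. p N i) \<longlonglongrightarrow> 0) \<and> (\<forall>i. (\<lambda>N. real N * p N i) \<longlonglongrightarrow> \<mu> i)"
    then interpret poisson_limit p \<mu> using mu_pos by unfold_locales auto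
    show "(\<forall>(M :: nat \<Rightarrow> 'w measure) (X :: nat \<Rightarrow> 'w \<Rightarrow> 'd option \<Rightarrow> nat).
           (\<forall>N. prob_space (M N) \<and> X N \<in> measurable (M N) (count_space UNIV) \<and>
                distr (M N) (count_space UNIV) (X N) =
                  measure_pmf (multinomial_pmf N (append_last (p N) (1 - total (p N))))) \<longrightarrow>
           weakly_converges
             (\<lambda>N. distr (M N) borel (\<lambda>\<omega>. real_vec (\<lambda>i. X N \<omega> (Some i))))
             (distr (measure_pmf (product_poisson \<mu>)) borel real_vec)) \<and>
        (\<forall>(x :: 'd \<Rightarrow> nat) (y :: 'd \<Rightarrow> nat) n.
           (\<lambda>N. multinomial_kernel_poly n
                  (append_last x (N - total x)) (append_last y (N - total y))
                  N (append_last (p N) (1 - total (p N))))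
             \<longlonglongrightarrow> poisson_kernel_poly n x y \<mu>)"
      using multinomial_kernel_poly_tendsto
      by (auto intro!: weakly_converges_drop_last simp: M_def)
  qed
next
  show "\<forall>x y. \<forall>\<rho>::real.
        summable (\<lambda>n. \<rho> ^ Suc n * poisson_kernel_poly (Suc n) x y \<mu>) \<and>
        1 + (\<Sum>n. \<rho> ^ Suc n * poisson_kernel_poly (Suc n) x y \<mu>) =
          exp (total \<mu> * \<rho>) *
          (\<Sum>z | z \<le> x \<and> z \<le> y.
             \<rho> ^ total z * (1 - \<rho>) ^ (total x + total y - 2 * total z) *
             (\<Prod>i\<in>UNIV. falling (x i) (z i) * falling (y i) (z i) / (\<mu> i ^ z i * fact (z i)))) \<and>
        (0 \<le> \<rho> \<and> \<rho> \<le> 1 \<longrightarrow>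
          0 \<le> 1 + (\<Sum>n. \<rho> ^ Suc n * poisson_kernel_poly (Suc n) x y \<mu>))"
    unfolding poisson_kernel_sum_def[symmetric]
  proof (intro allI)
    fix x y and \<rho> :: real
    note series = poisson_kernel_series[of \<mu> \<rho> x y, OF mu_pos]
    have sum: "1 + (\<Sum>n. \<rho> ^ Suc n * poisson_kernel_poly (Suc n) x y \<mu>) = poisson_kernel_sum \<mu> x y \<rho>"
      using sums_unique[OF series] by simp
    then show "summable (\<lambda>n. \<rho> ^ Suc n * poisson_kernel_poly (Suc n) x y \<mu>) \<and>
        1 + (\<Sum>n. \<rho> ^ Suc n * poisson_kernel_poly (Suc n) x y \<mu>) = poisson_kernel_sum \<mu> x y \<rho> \<and>
        (0 \<le> \<rho> \<and> \<rho> \<le> 1 \<longrightarrow>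
          0 \<le> 1 + (\<Sum>n. \<rho> ^ Suc n * poisson_kernel_poly (Suc n) x y \<mu>))"
      unfolding sum using sums_summable[OF series] poisson_kernel_sum_nonneg[of \<mu> \<rho> x y, OF mu_pos] by blast
  qed
qed (intro allI poisson_kernel_poly_charlier mu_pos)

end
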